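(* Let $\varphi=\Omega(1)$ and $d=O(1)$. Consider the promise problem whose input is a $d$-regular graph $G=(V,E)$ on $n$ vertices (accessed in the adjacency list model) that is guaranteed to be either (i) a $\varphi$-expander on $n$ vertices, or (ii) the disjoint union of two identical $\varphi$-expanders, each on $n/2$ vertices; the goal is to decide which case holds. For any trade-off parameter $1\le M\le O(\sqrt{n})$, there exists an algorithm that, with probability at least $1-2n^{-100}$, solves this problem, uses $\widetilde O(M)$ bits of space, and runs in $\widetilde O(n/M)$ time.
   Context: For a graph $G$, $\mathrm{vol}(C)=\sum_{v\in C}d_v$ and $\phi_{\mathrm{out}}(C,V)=|E(C,V\setminus C)|/\mathrm{vol}(C)$. The conductance of $G$ is $\phi(G)=\min_{C\subseteq V,\,0<\mathrm{vol}(C)\le\mathrm{vol}(V)/2}\phi_{\mathrm{out}}(C,V)$, and $G$ is a $\varphi$-expander if $\phi(G)\ge\varphi$. In the adjacency list model the algorithm can query any neighbor of a specified vertex in constant time. $\widetilde O$ hides $\mathrm{poly}(\log n)$ factors. *)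

theory Defs
  imports "HOL-Probability.Probability" "HOL-Library.Monad_Syntax" "Graph_Theory.Graph_Theory"
begin

section \<open>Conductance and expanders\<close>

text \<open>Finite simple undirected graphs are represented by the locale \<^locale>\<open>pair_graph\<close>: an
  undirected edge is a pair of opposite arcs, so that the degree of a vertex is its out-degree and
  the edges between \<open>C\<close> and its complement correspond to the arcs leaving \<open>C\<close>.\<close>

definition vol :: "'a pair_pre_digraph \<Rightarrow> 'a set \<Rightarrow> nat" where
  "vol G C = (\<Sum>v\<in>C. out_degree G v)"

definition cut_arcs :: "'a pair_pre_digraph \<Rightarrow> 'a set \<Rightarrow> ('a \<times> 'a) set" where
  "cut_arcs G C = {(u, v) \<in> parcs G. u \<in> C \<and> v \<in> pverts G - C}"

definition phi_out :: "'a pair_pre_digraph \<Rightarrow> 'a set \<Rightarrow> real" where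
  "phi_out G C = real (card (cut_arcs G C)) / real (vol G C)"

text \<open>The minimum ranges over a nonempty set as soon as \<open>G\<close> is regular of positive degree.\<close>

definition conductance :: "'a pair_pre_digraph \<Rightarrow> real" where
  "conductance G =
     Min (phi_out G ` {C. C \<subseteq> pverts G \<and> 0 < vol G C \<and> real (vol G C) \<le> real (vol G (pverts G)) / 2})"

definition expander :: "real \<Rightarrow> 'a pair_pre_digraph \<Rightarrow> bool" where
  "expander \<phi> G \<longleftrightarrow> pair_graph G \<and> \<phi> \<le> conductance G"

definition regular :: "nat \<Rightarrow> 'a pair_pre_digraph \<Rightarrow> bool" where
  "regular d G \<longleftrightarrow> (\<forall>v\<in>pverts G. out_degree G v = d)"

definition two_identical_expanders :: "real \<Rightarrow> 'a pair_pre_digraph \<Rightarrow> bool" where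
  "two_identical_expanders \<phi> G \<longleftrightarrow>
     (\<exists>H\<^sub>1 H\<^sub>2 :: 'a pair_pre_digraph.
        pverts H\<^sub>1 \<inter> pverts H\<^sub>2 = {} \<and>
        pverts G = pverts H\<^sub>1 \<union> pverts H\<^sub>2 \<and> parcs G = parcs H\<^sub>1 \<union> parcs H\<^sub>2 \<and>
        2 * card (pverts H\<^sub>1) = card (pverts G) \<and> 2 * card (pverts H\<^sub>2) = card (pverts G) \<and>
        digraph_iso (with_proj H\<^sub>1) (with_proj H\<^sub>2) \<and> expander \<phi> H\<^sub>1 \<and> expander \<phi> H\<^sub>2)"

text \<open>Entry \<open>v\<close> of an adjacency list representation of a graph on \<open>{0..<n}\<close> lists the neighbours
  of \<open>v\<close> in an arbitrary order.\<close>

definition adjacency_lists :: "nat pair_pre_digraph \<Rightarrow> nat list list \<Rightarrow> bool" where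
  "adjacency_lists G adj \<longleftrightarrow>
     pverts G = {..<length adj} \<and>
     (\<forall>v<length adj. distinct (adj ! v) \<and> set (adj ! v) = {u. (v, u) \<in> parcs G})"


section \<open>Randomised word RAM with adjacency list queries\<close>

text \<open>Programs of a structured language operate on a memory consisting of a fixed number of cells,
  each holding a word of \<open>w\<close> bits; addresses are words as well. The memory of a run with \<open>s\<close> cells
  therefore occupies \<open>w * s\<close> bits, and the control state adds only \<open>O(1)\<close> bits, since a
  fixed program has finitely many residual commands. A program is a finite object that does not
  depend on the input, so every command evaluates a bounded number of word operations and the
  running time is measured, up to a constant factor, by the number of small steps.
  The result \<^const>\<open>None\<close> stands for a fault, e.g. an access beyond the available memory.\<close>

datatype binop = Add | Sub | Mul | Div | Mod | Less | Eq

datatype exp = Const nat | Load exp | Bin binop exp exp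

datatype com =
    Skip
  | Store exp exp          \<comment> \<open>address, value\<close>
  | Rand exp exp           \<comment> \<open>address, bound: store a uniformly random number below the bound\<close>
  | Query exp exp exp      \<comment> \<open>address, vertex, index: store the neighbour of the vertex with this index\<close>
  | Seq com com
  | Cond exp com com
  | While exp com

type_synonym memory = "nat list"

fun binop_val :: "binop \<Rightarrow> nat \<Rightarrow> nat \<Rightarrow> nat" where
  "binop_val Add x y = x + y"
| "binop_val Sub x y = x - y"
| "binop_val Mul x y = x * y"
| "binop_val Div x y = x div y"
| "binop_val Mod x y = x mod y"
| "binop_val Less x y = (if x < y then 1 else 0)"
| "binop_val Eq x y = (if x = y then 1 else 0)"

fun lookup :: "'a list \<Rightarrow> nat \<Rightarrow> 'a option" where
  "lookup xs i = (if i < length xs then Some (xs ! i) else None)"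

fun put :: "memory \<Rightarrow> nat \<Rightarrow> nat \<Rightarrow> memory option" where
  "put m a x = (if a < length m then Some (m[a := x]) else None)"

fun eval :: "nat \<Rightarrow> memory \<Rightarrow> exp \<Rightarrow> nat option" where
  "eval w m (Const k) = Some (k mod 2 ^ w)"
| "eval w m (Load e) = do { a \<leftarrow> eval w m e; lookup m a }"
| "eval w m (Bin f e\<^sub>1 e\<^sub>2) =
     do { x \<leftarrow> eval w m e\<^sub>1; y \<leftarrow> eval w m e\<^sub>2; Some (binop_val f x y mod 2 ^ w) }"

fun step :: "nat \<Rightarrow> nat list list \<Rightarrow> com \<Rightarrow> memory \<Rightarrow> (com \<times> memory) option pmf" where
  "step w adj Skip m = return_pmf (Some (Skip, m))"
| "step w adj (Store e\<^sub>1 e\<^sub>2) m = return_pmf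
     (do { a \<leftarrow> eval w m e\<^sub>1; x \<leftarrow> eval w m e\<^sub>2; m' \<leftarrow> put m a x; Some (Skip, m') })"
| "step w adj (Rand e\<^sub>1 e\<^sub>2) m =
     (case (eval w m e\<^sub>1, eval w m e\<^sub>2) of
        (Some a, Some b) \<Rightarrow>
          if b = 0 then return_pmf None
          else map_pmf (\<lambda>x. do { m' \<leftarrow> put m a x; Some (Skip, m') }) (pmf_of_set {..<b})
      | _ \<Rightarrow> return_pmf None)"
| "step w adj (Query e\<^sub>1 e\<^sub>2 e\<^sub>3) m = return_pmf
     (do { a \<leftarrow> eval w m e\<^sub>1; v \<leftarrow> eval w m e\<^sub>2; i \<leftarrow> eval w m e\<^sub>3;
           ns \<leftarrow> lookup adj v; u \<leftarrow> lookup ns i;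
           m' \<leftarrow> put m a (u mod 2 ^ w); Some (Skip, m') })"
| "step w adj (Seq c\<^sub>1 c\<^sub>2) m =
     (if c\<^sub>1 = Skip then return_pmf (Some (c\<^sub>2, m))
      else map_pmf (map_option (\<lambda>(c, m'). (Seq c c\<^sub>2, m'))) (step w adj c\<^sub>1 m))"
| "step w adj (Cond e c\<^sub>1 c\<^sub>2) m = return_pmf
     (do { x \<leftarrow> eval w m e; Some (if x \<noteq> 0 then c\<^sub>1 else c\<^sub>2, m) })"
| "step w adj (While e c) m = return_pmf (Some (Cond e (Seq c (While e c)) Skip, m))"

text \<open>Distribution of the configuration after \<open>t\<close> steps; \<^term>\<open>Some (Skip, m)\<close> and \<^const>\<open>None\<close> are
  absorbing.\<close>

fun run :: "nat \<Rightarrow> nat list list \<Rightarrow> nat \<Rightarrow> (com \<times> memory) option \<Rightarrow> (com \<times> memory) option pmf" where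
  "run w adj 0 x = return_pmf x"
| "run w adj (Suc t) x =
     bind_pmf (case x of None \<Rightarrow> return_pmf None | Some (c, m) \<Rightarrow> step w adj c m) (run w adj t)"

definition initial_memory :: "nat \<Rightarrow> nat \<Rightarrow> nat list \<Rightarrow> memory" where
  "initial_memory w s inputs = map (\<lambda>x. x mod 2 ^ w) inputs @ replicate (s - length inputs) 0"

definition halted :: "(com \<times> memory) option set" where
  "halted = {Some (Skip, m) | m. True}"

definition halted_with :: "nat \<Rightarrow> (com \<times> memory) option set" where
  "halted_with r = {Some (Skip, m) | m. lookup m 0 = Some r}"

text \<open>Words of \<open>c * \<lceil>log\<^sub>2 n\<rceil>\<close> bits, i.e. of length \<open>O(log n)\<close> for a constant \<open>c\<close>.\<close>

definition word_length :: "nat \<Rightarrow> nat \<Rightarrow> nat" where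
  "word_length c n = c * nat \<lceil>log 2 (real n)\<rceil>"

end

theory Submission
  imports Defs
begin

text \<open>Lazy random walks of length \<open>C * bits n\<close> on a \<open>\<phi>\<close>-expander end at every vertex with probability
  at least \<open>1 / (2 * n)\<close>: by Cheeger's argument each step contracts the \<open>L\<^sup>2\<close> distance to the uniform
  distribution by a constant factor.

  The algorithm first runs \<open>404 * M * bits n\<close> walks from vertex 0 and stores each endpoint \<open>u\<close> in the
  direct-mapped table cell \<open>u mod M\<close>, so that membership of a vertex in the stored set is tested by a
  single lookup. On an expander all cells get filled with high probability (coupon collector). It then
  performs \<open>100 * bits n\<close> rounds; in each it picks a uniform vertex \<open>v\<close>, runs
  \<open>216 * bits n * (n div M + 1)\<close> walks from \<open>v\<close>, and reports two components if none of them ends in the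
  table. On an expander a walk hits the table with probability about \<open>M / (2 * n)\<close>, hence every round has
  a hit with high probability. On two components a round is without hit as soon as \<open>v\<close> lies outside the
  component of vertex 0, which has probability one half.\<close>

section \<open>Contraction of the lazy walk on an expander\<close>

text \<open>A hit certifies that \<open>v\<close> lies in the component of vertex 0. On two
  components only an unlucky choice of \<open>v\<close> can therefore hide the truth, whereas on an
  expander every single round has to produce a hit. This asymmetry shapes the constants: on an
  expander the exponents of the error keep a reserve (101 and 108 instead of 100 times
  \<open>bits n\<close>) for union bounds over cells and rounds.

  Laziness is what allows contraction to follow from conductance alone, since the plain walk on a
  bipartite expander never mixes. It also replaces spectral theory: one lazy step averages
  midpoints, and squaring a midpoint exposes the energy that is lost.

  For the running time the obstacle is the filling phase, which needs about \<open>M\<close> walks;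
  it fits into \<open>n / M\<close> up to logarithms because \<open>M\<close> is at most of order
  \<open>sqrt n\<close>.

  On the machine side every loop is shown to realise a Markov kernel on an abstract state, so the
  probabilistic analysis never mentions memory.\<close>

lemma sum_sq_diff_const:
  fixes f :: "'a \<Rightarrow> real"
  shows "(\<Sum>v\<in>A. (f v - c)\<^sup>2) = (\<Sum>v\<in>A. (f v)\<^sup>2) - 2 * c * (\<Sum>v\<in>A. f v) + real (card A) * c\<^sup>2"
  by (simp add: power2_diff sum.distrib sum_subtractf sum_distrib_left sum_distrib_right mult_ac)

text \<open>\<open>E\<close> contains both orientations of each edge, so sums over \<open>E\<close>
  count undirected edges twice. \<open>\<phi>\<close> is any lower bound on the conductance; as all
  degrees equal \<open>d\<close>, volumes are \<open>d\<close> times cardinalities, which gives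
  \<open>expansion\<close> its form.\<close>

locale edge_expander =
  fixes V :: "'a set" and E :: "('a \<times> 'a) set" and d :: nat and \<phi> :: real
  assumes finite_V: "finite V"
    and E_subset: "E \<subseteq> V \<times> V"
    and E_sym: "(u, v) \<in> E \<Longrightarrow> (v, u) \<in> E"
    and degree: "v \<in> V \<Longrightarrow> card {u. (v, u) \<in> E} = d"
    and d_pos: "0 < d"
    and \<phi>_pos: "0 < \<phi>"
    and expansion: "C \<subseteq> V \<Longrightarrow> C \<noteq> {} \<Longrightarrow> 2 * card C \<le> card V \<Longrightarrow>
      \<phi> * real d * real (card C) \<le> real (card {e \<in> E. fst e \<in> C \<and> snd e \<notin> C})"
begin

lemma finite_E: "finite E"
  using finite_V E_subset by (meson finite_SigmaI finite_subset)

lemma sum_arcs: "(\<Sum>e\<in>E. g (fst e) (snd e)) = (\<Sum>v\<in>V. \<Sum>u | (v, u) \<in> E. g v u)"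
  for g :: "'a \<Rightarrow> 'a \<Rightarrow> real"
proof -
  have "E = Sigma V (\<lambda>v. {u. (v, u) \<in> E})"
    using E_subset by auto
  moreover have "finite {u. (v, u) \<in> E}" for v
    by (rule finite_subset[OF _ finite_V]) (use E_subset in auto)
  ultimately show ?thesis
    using sum.Sigma[OF finite_V, of "\<lambda>v. {u. (v, u) \<in> E}" g] by (simp add: case_prod_beta)
qed

lemma sum_arcs_fst: "(\<Sum>e\<in>E. h (fst e)) = real d * (\<Sum>v\<in>V. h v)" for h :: "'a \<Rightarrow> real"
  using sum_arcs[of "\<lambda>v _. h v"] by (simp add: degree sum_distrib_left)

lemma sum_arcs_swap: "(\<Sum>e\<in>E. g (fst e) (snd e)) = (\<Sum>e\<in>E. g (snd e) (fst e))"
  for g :: "'a \<Rightarrow> 'a \<Rightarrow> real"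
  by (rule sum.reindex_bij_witness[where i = prod.swap and j = prod.swap]) (auto intro: E_sym)

lemma sum_arcs_snd: "(\<Sum>e\<in>E. h (snd e)) = real d * (\<Sum>v\<in>V. h v)" for h :: "'a \<Rightarrow> real"
  using sum_arcs_swap[of "\<lambda>v _. h v"] sum_arcs_fst by simp

text \<open>Co-area inequality: peel off the superlevel sets of \<open>a\<close>, starting with its support.\<close>

lemma sum_abs_diff_ge:
  fixes a :: "'a \<Rightarrow> real"
  assumes "\<And>v. v \<in> V \<Longrightarrow> 0 \<le> a v" and "2 * card {v \<in> V. 0 < a v} \<le> card V"
  shows "2 * \<phi> * real d * (\<Sum>v\<in>V. a v) \<le> (\<Sum>e\<in>E. \<bar>a (fst e) - a (snd e)\<bar>)"
  using assms
proof (induction "card {v \<in> V. 0 < a v}" arbitrary: a rule: less_induct)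
  case less
  define A where "A = {v \<in> V. 0 < a v}"
  have fA: "finite A" using finite_V by (simp add: A_def)
  show ?case
  proof (cases "A = {}")
    case True
    then have "\<And>v. v \<in> V \<Longrightarrow> a v = 0"
      using less.prems(1) by (force simp: A_def)
    then show ?thesis by (simp add: sum_nonneg)
  next
    case False
    define \<epsilon> where "\<epsilon> = Min (a ` A)"
    define b where "b v = (if v \<in> A then a v - \<epsilon> else 0)" for v
    have \<epsilon>_le: "\<epsilon> \<le> a v" if "v \<in> A" for v
      using that fA by (simp add: \<epsilon>_def)
    have "\<epsilon> \<in> a ` A" using False fA by (simp add: \<epsilon>_def)
    then obtain x where x: "x \<in> A" "a x = \<epsilon>" by auto
    then have \<epsilon>_pos: "\<epsilon> > 0" by (auto simp: A_def)
    have a0: "a v = 0" if "v \<in> V" "v \<notin> A" for v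
      using that less.prems(1)[of v] by (auto simp: A_def)
    have supp: "{v \<in> V. 0 < b v} \<subset> A"
      using x by (auto simp: b_def)
    then have card: "card {v \<in> V. 0 < b v} < card A"
      using fA by (rule psubset_card_mono[rotated])
    have IH: "2 * \<phi> * real d * (\<Sum>v\<in>V. b v) \<le> (\<Sum>e\<in>E. \<bar>b (fst e) - b (snd e)\<bar>)"
    proof (rule less.hyps)
      show "card {v \<in> V. 0 < b v} < card {v \<in> V. 0 < a v}"
        using card by (simp add: A_def)
      then show "2 * card {v \<in> V. 0 < b v} \<le> card V"
        using less.prems(2) by simp
      show "0 \<le> b v" if "v \<in> V" for v
        using \<epsilon>_le by (simp add: b_def)
    qed
    have "(\<Sum>v\<in>V. a v) = (\<Sum>v\<in>V. b v + (if v \<in> A then \<epsilon> else 0))"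
      by (rule sum.cong) (auto simp: b_def a0)
    also have "\<dots> = (\<Sum>v\<in>V. b v) + \<epsilon> * real (card A)"
    proof -
      have "V \<inter> A = A" by (auto simp: A_def)
      then show ?thesis
        by (simp add: sum.distrib sum.If_cases finite_V)
    qed
    finally have sum_a: "(\<Sum>v\<in>V. a v) = (\<Sum>v\<in>V. b v) + \<epsilon> * real (card A)" .
    let ?g = "\<lambda>u v. if u \<in> A \<and> v \<notin> A then \<epsilon> else 0"
    have cut: "(\<Sum>e\<in>E. ?g (fst e) (snd e)) = \<epsilon> * real (card {e \<in> E. fst e \<in> A \<and> snd e \<notin> A})"
      by (subst sum.inter_filter[OF finite_E, symmetric]) simp
    \<comment> \<open>Lowering \<open>a\<close> by \<open>\<epsilon>\<close> on its support keeps
      the differences inside \<open>A\<close> and shrinks those across its boundary by exactly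
      \<open>\<epsilon>\<close>. The cut is met in both orientations, whence the factor 2
      below.\<close>
    have "(\<Sum>e\<in>E. \<bar>a (fst e) - a (snd e)\<bar>) =
        (\<Sum>e\<in>E. \<bar>b (fst e) - b (snd e)\<bar> + ?g (fst e) (snd e) + ?g (snd e) (fst e))"
    proof (rule sum.cong)
      fix e assume "e \<in> E"
      then have "fst e \<in> V" "snd e \<in> V" using E_subset by auto
      then show "\<bar>a (fst e) - a (snd e)\<bar> =
          \<bar>b (fst e) - b (snd e)\<bar> + ?g (fst e) (snd e) + ?g (snd e) (fst e)"
        using \<epsilon>_le[of "fst e"] \<epsilon>_le[of "snd e"] \<epsilon>_pos a0[of "fst e"] a0[of "snd e"]
        by (auto simp: b_def)
    qed simp
    also have "\<dots> = (\<Sum>e\<in>E. \<bar>b (fst e) - b (snd e)\<bar>) +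
        2 * (\<epsilon> * real (card {e \<in> E. fst e \<in> A \<and> snd e \<notin> A}))"
      using sum_arcs_swap[of ?g] cut by (simp add: sum.distrib)
    also have "\<dots> \<ge> 2 * \<phi> * real d * (\<Sum>v\<in>V. b v) + 2 * (\<epsilon> * (\<phi> * real d * real (card A)))"
    proof -
      have "\<phi> * real d * real (card A) \<le> real (card {e \<in> E. fst e \<in> A \<and> snd e \<notin> A})"
        using False less.prems(2) by (intro expansion) (auto simp: A_def)
      then have "\<epsilon> * (\<phi> * real d * real (card A)) \<le> \<epsilon> * real (card {e \<in> E. fst e \<in> A \<and> snd e \<notin> A})"
        using \<epsilon>_pos by simp
      then show ?thesis using IH by linarith
    qed
    finally show ?thesis
      by (simp add: sum_a algebra_simps)
  qed
qed

text \<open>Cheeger's argument: apply the co-area inequality to the square of \<open>h\<close>,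
  factor the difference of squares, and use Cauchy-Schwarz. The factor with the sums
  \<open>h u + h v\<close> is at most \<open>4 * d * S\<close>, and one \<open>S\<close>
  cancels.\<close>

lemma sum_sq_diff_ge_half_support:
  fixes h :: "'a \<Rightarrow> real"
  assumes nn: "\<And>v. v \<in> V \<Longrightarrow> 0 \<le> h v" and supp: "2 * card {v \<in> V. 0 < h v} \<le> card V"
  shows "\<phi>\<^sup>2 * real d * (\<Sum>v\<in>V. (h v)\<^sup>2) \<le> (\<Sum>e\<in>E. (h (fst e) - h (snd e))\<^sup>2)"
proof -
  define S where "S = (\<Sum>v\<in>V. (h v)\<^sup>2)"
  define X where "X = (\<Sum>e\<in>E. (h (fst e) - h (snd e))\<^sup>2)"
  have S0: "0 \<le> S" by (simp add: S_def sum_nonneg)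
  have X0: "0 \<le> X" by (simp add: X_def sum_nonneg)
  have eq: "{v \<in> V. 0 < (h v)\<^sup>2} = {v \<in> V. 0 < h v}"
    using nn by (auto simp: less_le)
  have "2 * \<phi> * real d * S \<le> (\<Sum>e\<in>E. \<bar>(h (fst e))\<^sup>2 - (h (snd e))\<^sup>2\<bar>)"
    unfolding S_def by (rule sum_abs_diff_ge) (use supp eq in auto)
  also have "\<dots> = (\<Sum>e\<in>E. \<bar>h (fst e) - h (snd e)\<bar> * \<bar>h (fst e) + h (snd e)\<bar>)"
    by (intro sum.cong) (auto simp: abs_mult[symmetric] power2_eq_square algebra_simps)
  finally have "(2 * \<phi> * real d * S)\<^sup>2 \<le> (\<Sum>e\<in>E. \<bar>h (fst e) - h (snd e)\<bar> * \<bar>h (fst e) + h (snd e)\<bar>)\<^sup>2"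
    using S0 \<phi>_pos by (intro power_mono) auto
  also have "\<dots> \<le> (\<Sum>e\<in>E. \<bar>h (fst e) - h (snd e)\<bar>\<^sup>2) * (\<Sum>e\<in>E. \<bar>h (fst e) + h (snd e)\<bar>\<^sup>2)"
    by (rule Cauchy_Schwarz_ineq_sum)
  also have "\<dots> = X * (\<Sum>e\<in>E. (h (fst e) + h (snd e))\<^sup>2)"
    by (simp add: X_def)
  also have "\<dots> \<le> X * (\<Sum>e\<in>E. 2 * (h (fst e))\<^sup>2 + 2 * (h (snd e))\<^sup>2)"
  proof (intro mult_left_mono sum_mono X0)
    fix e show "(h (fst e) + h (snd e))\<^sup>2 \<le> 2 * (h (fst e))\<^sup>2 + 2 * (h (snd e))\<^sup>2"
      using zero_le_power2[of "h (fst e) - h (snd e)"]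
      by (simp add: power2_eq_square algebra_simps)
  qed
  also have "\<dots> = X * (4 * real d * S)"
    using sum_arcs_fst[of "\<lambda>v. (h v)\<^sup>2"] sum_arcs_snd[of "\<lambda>v. (h v)\<^sup>2"]
    by (simp add: sum.distrib sum_distrib_left[symmetric] S_def)
  finally have *: "(\<phi>\<^sup>2 * real d * S) * (4 * real d * S) \<le> X * (4 * real d * S)"
    by (simp add: power2_eq_square algebra_simps)
  show ?thesis
  proof (cases "S = 0")
    case True
    then show ?thesis using X0 by (simp add: S_def X_def)
  next
    case False
    then have "0 < 4 * real d * S" using S0 d_pos by simp
    with * have "\<phi>\<^sup>2 * real d * S \<le> X" by (rule mult_right_le_imp_le)
    then show ?thesis by (simp add: S_def X_def)
  qed
qed

text \<open>Cutting at a median leaves the positive and the negative part of \<open>f - m\<close>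
  each supported on at most half of the vertices, as expansion demands. The witness is the least
  value of \<open>f\<close> that is exceeded on at most half of \<open>V\<close>.\<close>

lemma ex_median:
  fixes f :: "'a \<Rightarrow> real"
  assumes "V \<noteq> {}"
  obtains m where "2 * card {v \<in> V. m < f v} \<le> card V" "2 * card {v \<in> V. f v < m} \<le> card V"
proof -
  define Q where "Q = {x \<in> f ` V. 2 * card {v \<in> V. x < f v} \<le> card V}"
  have fQ: "finite Q" using finite_V by (simp add: Q_def)
  have "Max (f ` V) \<in> Q"
  proof -
    have "{v \<in> V. Max (f ` V) < f v} = {}"
      using finite_V by (auto simp: not_less)
    then have "card {v \<in> V. Max (f ` V) < f v} = 0"
      by (simp only: card.empty)
    moreover have "Max (f ` V) \<in> f ` V" using finite_V assms by simp
    ultimately show ?thesis 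
      unfolding Q_def by (intro CollectI conjI) linarith+
  qed
  then have "Min Q \<in> Q" using fQ by (intro Min_in) auto
  then have m: "2 * card {v \<in> V. Min Q < f v} \<le> card V" by (simp add: Q_def)
  have "2 * card {v \<in> V. f v < Min Q} \<le> card V"
  proof (cases "{v \<in> V. f v < Min Q} = {}")
    case True
    then show ?thesis by (metis card.empty mult_0_right zero_le)
  next
    case False
    define W where "W = f ` {v \<in> V. f v < Min Q}"
    have W: "finite W" "W \<noteq> {}" using finite_V False by (auto simp: W_def)
    \<comment> \<open>The next smaller value of \<open>f\<close>: minimality of \<open>Min Q\<close>
      puts more than half of \<open>V\<close> above \<open>x\<close>, and every value below
      \<open>Min Q\<close> is at most \<open>x\<close>.\<close>
    define x where "x = Max W"
    have xW: "x \<in> W" using W by (simp add: x_def)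
    then have "x \<in> f ` V" "x < Min Q" by (auto simp: W_def)
    have "x \<notin> Q"
      using \<open>x < Min Q\<close> Min_le[OF fQ, of x] by auto
    then have big: "card V < 2 * card {v \<in> V. x < f v}"
      using \<open>x \<in> f ` V\<close> by (auto simp: Q_def)
    have "{v \<in> V. f v < Min Q} \<subseteq> V - {v \<in> V. x < f v}"
      using W by (auto simp: x_def W_def not_less intro!: Max_ge)
    then have "card {v \<in> V. f v < Min Q} \<le> card (V - {v \<in> V. x < f v})"
      using finite_V by (intro card_mono) auto
    also have "\<dots> = card V - card {v \<in> V. x < f v}"
      using finite_V by (intro card_Diff_subset) auto
    finally show ?thesis using big by linarith
  qed
  with m that show ?thesis by blast
qed

text \<open>As \<open>f\<close> has mean zero, shifting it by the median can only increase its
  square norm. Both parts of \<open>f - m\<close> satisfy the half-support bound, and their energies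
  add up to at most the energy of \<open>f\<close>.\<close>

lemma poincare:
  fixes f :: "'a \<Rightarrow> real"
  assumes "(\<Sum>v\<in>V. f v) = 0"
  shows "\<phi>\<^sup>2 * real d * (\<Sum>v\<in>V. (f v)\<^sup>2) \<le> (\<Sum>e\<in>E. (f (fst e) - f (snd e))\<^sup>2)"
proof (cases "V = {}")
  case True
  then show ?thesis by (simp add: sum_nonneg)
next
  case False
  then obtain m where m: "2 * card {v \<in> V. m < f v} \<le> card V" "2 * card {v \<in> V. f v < m} \<le> card V"
    by (rule ex_median)
  define p q where "p v = max (f v - m) 0" and "q v = max (m - f v) 0" for v
  have "{v \<in> V. 0 < p v} = {v \<in> V. m < f v}" "{v \<in> V. 0 < q v} = {v \<in> V. f v < m}"
    by (auto simp: p_def q_def less_max_iff_disj)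
  then have pq: "\<phi>\<^sup>2 * real d * (\<Sum>v\<in>V. (p v)\<^sup>2) \<le> (\<Sum>e\<in>E. (p (fst e) - p (snd e))\<^sup>2)"
      "\<phi>\<^sup>2 * real d * (\<Sum>v\<in>V. (q v)\<^sup>2) \<le> (\<Sum>e\<in>E. (q (fst e) - q (snd e))\<^sup>2)"
    using m by (intro sum_sq_diff_ge_half_support; simp add: p_def q_def)+
  have "(\<Sum>v\<in>V. (f v)\<^sup>2) \<le> (\<Sum>v\<in>V. (f v)\<^sup>2) + real (card V) * m\<^sup>2 - 2 * m * (\<Sum>v\<in>V. f v)"
    using assms by simp
  also have "\<dots> = (\<Sum>v\<in>V. (f v - m)\<^sup>2)"
    by (simp add: sum_sq_diff_const)
  also have "\<dots> = (\<Sum>v\<in>V. (p v)\<^sup>2) + (\<Sum>v\<in>V. (q v)\<^sup>2)"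
    unfolding sum.distrib[symmetric]
    by (rule sum.cong) (auto simp: p_def q_def max_def power2_commute)
  finally have "\<phi>\<^sup>2 * real d * (\<Sum>v\<in>V. (f v)\<^sup>2) \<le>
      \<phi>\<^sup>2 * real d * ((\<Sum>v\<in>V. (p v)\<^sup>2) + (\<Sum>v\<in>V. (q v)\<^sup>2))"
    by (intro mult_left_mono) auto
  also have "\<dots> \<le> (\<Sum>e\<in>E. (p (fst e) - p (snd e))\<^sup>2 + (q (fst e) - q (snd e))\<^sup>2)"
    using pq by (simp add: sum.distrib distrib_left)
  also have "\<dots> \<le> (\<Sum>e\<in>E. (f (fst e) - f (snd e))\<^sup>2)"
  proof (rule sum_mono)
    \<comment> \<open>For opposite signs the parts contribute \<open>x\<^sup>2 + y\<^sup>2\<close>,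
      and the missing term \<open>- 2 * x * y\<close> is nonnegative; for equal signs there is
      equality.\<close>
    have *: "(max x 0 - max y 0)\<^sup>2 + (max (-x) 0 - max (-y) 0)\<^sup>2 \<le> (x - y)\<^sup>2" for x y :: real
    proof (cases "0 \<le> x"; cases "0 \<le> y")
      assume "0 \<le> x" "\<not> 0 \<le> y"
      moreover from this have "x * y \<le> 0" by (simp add: mult_nonneg_nonpos)
      ultimately show ?thesis by (simp add: max_def power2_diff)
    next
      assume "\<not> 0 \<le> x" "0 \<le> y"
      moreover from this have "x * y \<le> 0" by (simp add: mult_nonpos_nonneg)
      ultimately show ?thesis by (simp add: max_def power2_diff)
    qed (auto simp: max_def power2_commute)
    show "(p (fst e) - p (snd e))\<^sup>2 + (q (fst e) - q (snd e))\<^sup>2 \<le> (f (fst e) - f (snd e))\<^sup>2" for e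
      using *[of "f (fst e) - m" "f (snd e) - m"] by (simp add: p_def q_def)
  qed
  finally show ?thesis .
qed

text \<open>The transition operator \<open>(I + P) / 2\<close> acting on functions of the starting
  vertex. By symmetry and regularity of \<open>E\<close> it also preserves total mass.\<close>

definition lazy_avg :: "('a \<Rightarrow> real) \<Rightarrow> 'a \<Rightarrow> real" where
  "lazy_avg f v = f v / 2 + (\<Sum>u | (v, u) \<in> E. f u) / (2 * real d)"

lemma sum_lazy_avg: "(\<Sum>v\<in>V. lazy_avg f v) = (\<Sum>v\<in>V. f v)"
proof -
  have "(\<Sum>v\<in>V. lazy_avg f v) = (\<Sum>v\<in>V. f v) / 2 + (\<Sum>v\<in>V. \<Sum>u | (v, u) \<in> E. f u) / (2 * real d)"
    by (simp add: lazy_avg_def sum.distrib sum_divide_distrib)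
  also have "(\<Sum>v\<in>V. \<Sum>u | (v, u) \<in> E. f u) = real d * (\<Sum>v\<in>V. f v)"
    using sum_arcs[of "\<lambda>_ u. f u"] sum_arcs_snd by simp
  finally show ?thesis using d_pos by simp
qed

text \<open>By laziness the new value is the mean of the midpoints \<open>(f v + f u) / 2\<close>
  over the neighbours \<open>u\<close>. Convexity of the square and \<open>((a + b) / 2)\<^sup>2 =
  (a\<^sup>2 + b\<^sup>2) / 2 - (a - b)\<^sup>2 / 4\<close> isolate a loss proportional to the
  energy, which \<open>poincare\<close> bounds from below.\<close>

lemma sum_sq_lazy_avg_le:
  assumes "(\<Sum>v\<in>V. f v) = 0"
  shows "(\<Sum>v\<in>V. (lazy_avg f v)\<^sup>2) \<le> (1 - \<phi>\<^sup>2 / 4) * (\<Sum>v\<in>V. (f v)\<^sup>2)"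
proof -
  have "(lazy_avg f v)\<^sup>2 \<le> (\<Sum>u | (v, u) \<in> E. ((f v + f u) / 2)\<^sup>2) / real d" if v: "v \<in> V" for v
  proof -
    have "lazy_avg f v = (\<Sum>u | (v, u) \<in> E. (f v + f u) / 2) / real d"
      using d_pos by (simp add: lazy_avg_def sum.distrib degree[OF v] sum_divide_distrib[symmetric] field_simps)
    then have "(lazy_avg f v)\<^sup>2 = (\<Sum>u | (v, u) \<in> E. (f v + f u) / 2)\<^sup>2 / (real d)\<^sup>2"
      by (simp add: power_divide)
    also have "\<dots> \<le> ((\<Sum>u | (v, u) \<in> E. ((f v + f u) / 2)\<^sup>2) * card {u. (v, u) \<in> E}) / (real d)\<^sup>2"
      by (intro divide_right_mono sum_squared_le_sum_of_squares) auto
    also have "\<dots> = (\<Sum>u | (v, u) \<in> E. ((f v + f u) / 2)\<^sup>2) / real d"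
      using d_pos by (simp add: degree[OF v] power2_eq_square)
    finally show ?thesis .
  qed
  then have "(\<Sum>v\<in>V. (lazy_avg f v)\<^sup>2) \<le> (\<Sum>v\<in>V. (\<Sum>u | (v, u) \<in> E. ((f v + f u) / 2)\<^sup>2) / real d)"
    by (rule sum_mono)
  also have "\<dots> = (\<Sum>e\<in>E. ((f (fst e) + f (snd e)) / 2)\<^sup>2) / real d"
    using sum_arcs[of "\<lambda>v u. ((f v + f u) / 2)\<^sup>2"] by (simp add: sum_divide_distrib)
  also have "(\<Sum>e\<in>E. ((f (fst e) + f (snd e)) / 2)\<^sup>2) =
      (\<Sum>e\<in>E. (f (fst e))\<^sup>2 / 2 + (f (snd e))\<^sup>2 / 2 - (f (fst e) - f (snd e))\<^sup>2 / 4)"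
    by (rule sum.cong) (auto simp: power2_eq_square field_simps)
  also have "\<dots> = real d * (\<Sum>v\<in>V. (f v)\<^sup>2) - (\<Sum>e\<in>E. (f (fst e) - f (snd e))\<^sup>2) / 4"
    using sum_arcs_fst[of "\<lambda>v. (f v)\<^sup>2 / 2"] sum_arcs_snd[of "\<lambda>v. (f v)\<^sup>2 / 2"]
    by (simp add: sum.distrib sum_subtractf sum_divide_distrib[symmetric])
  also have "\<dots> \<le> real d * (\<Sum>v\<in>V. (f v)\<^sup>2) - \<phi>\<^sup>2 * real d * (\<Sum>v\<in>V. (f v)\<^sup>2) / 4"
    using poincare[OF assms] by simp
  also have "\<dots> = real d * ((1 - \<phi>\<^sup>2 / 4) * (\<Sum>v\<in>V. (f v)\<^sup>2))"
    by (simp add: algebra_simps)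
  finally show ?thesis using d_pos by (simp add: divide_right_mono)
qed

lemma lazy_avg_diff_const: 
  assumes "v \<in> V"
  shows "lazy_avg (\<lambda>u. f u - c) v = lazy_avg f v - c"
  using d_pos by (simp add: lazy_avg_def sum_subtractf degree[OF assms] field_simps)

text \<open>The deviation from \<open>1 / card V\<close> has sum zero, which averaging preserves, so
  the contraction applies at every step. Its initial square norm is at most 1, and a single
  coordinate is bounded by the whole norm. \<open>\<phi>_le\<close> keeps the contraction factor
  nonnegative.\<close>

lemma lazy_avg_iterates_near_uniform:
  fixes g :: "nat \<Rightarrow> 'a \<Rightarrow> real"
  assumes step: "\<And>t v. v \<in> V \<Longrightarrow> g (Suc t) v = lazy_avg (g t) v"
    and init: "\<And>v. v \<in> V \<Longrightarrow> g 0 v = of_bool (v = x)"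
    and x: "x \<in> V" and v: "v \<in> V" and \<phi>_le: "\<phi> \<le> 1"
  shows "(g t v - 1 / real (card V))\<^sup>2 \<le> (1 - \<phi>\<^sup>2 / 4) ^ t"
proof -
  define h where "h t v = g t v - 1 / real (card V)" for t v
  have n: "0 < card V" using x finite_V by (auto simp: card_gt_0_iff)
  have lam: "0 \<le> 1 - \<phi>\<^sup>2 / 4"
    using \<phi>_le \<phi>_pos power_le_one[of \<phi> 2] by simp
  have h_step: "h (Suc t) v = lazy_avg (h t) v" if "v \<in> V" for t v
    unfolding h_def using step[OF that] lazy_avg_diff_const[OF that] by simp
  have sum1: "(\<Sum>v\<in>V. g 0 v) = 1"
    using x finite_V init by (simp add: of_bool_def)
  have "(\<Sum>v\<in>V. h t v) = 0 \<and> (\<Sum>v\<in>V. (h t v)\<^sup>2) \<le> (1 - \<phi>\<^sup>2 / 4) ^ t" for t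
  proof (induction t)
    case 0
    have "(\<Sum>v\<in>V. (h 0 v)\<^sup>2) = (\<Sum>v\<in>V. (g 0 v)\<^sup>2) - 2 / real (card V) * (\<Sum>v\<in>V. g 0 v) + 1 / real (card V)"
      using n unfolding h_def sum_sq_diff_const by (simp add: power2_eq_square)
    also have "(\<Sum>v\<in>V. (g 0 v)\<^sup>2) = (\<Sum>v\<in>V. g 0 v)"
      by (rule sum.cong) (auto simp: init)
    also have "(\<Sum>v\<in>V. g 0 v) - 2 / real (card V) * (\<Sum>v\<in>V. g 0 v) + 1 / real (card V) \<le> 1"
      by (simp add: sum1)
    finally show ?case using n by (simp add: h_def sum_subtractf sum1)
  next
    case (Suc t)
    have "(\<Sum>v\<in>V. h (Suc t) v) = (\<Sum>v\<in>V. lazy_avg (h t) v)"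
      "(\<Sum>v\<in>V. (h (Suc t) v)\<^sup>2) = (\<Sum>v\<in>V. (lazy_avg (h t) v)\<^sup>2)"
      by (simp_all add: h_step)
    moreover have "(1 - \<phi>\<^sup>2 / 4) * (\<Sum>v\<in>V. (h t v)\<^sup>2) \<le> (1 - \<phi>\<^sup>2 / 4) * (1 - \<phi>\<^sup>2 / 4) ^ t"
      using Suc lam by (intro mult_left_mono) auto
    ultimately show ?case
      using Suc sum_lazy_avg[of "h t"] sum_sq_lazy_avg_le[of "h t"] by simp
  qed
  moreover have "(h t v)\<^sup>2 \<le> (\<Sum>v\<in>V. (h t v)\<^sup>2)"
    using v finite_V by (intro member_le_sum) auto
  ultimately show ?thesis unfolding h_def by (meson order_trans)
qed

end

section \<open>Reasoning about terminating runs\<close>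

text \<open>\<open>t\<close> is a worst-case bound over all random outcomes: after \<open>t\<close>
  steps the whole mass sits on terminated configurations, so faults are excluded. As
  \<open>Skip\<close> is absorbing, larger \<open>t\<close> serve as well and branches of unequal
  length can be padded.\<close>

definition computes :: "nat \<Rightarrow> nat list list \<Rightarrow> com \<Rightarrow> memory \<Rightarrow> nat \<Rightarrow> memory pmf \<Rightarrow> bool" where
  "computes w adj c m t \<mu> \<longleftrightarrow> run w adj t (Some (c, m)) = map_pmf (\<lambda>m'. Some (Skip, m')) \<mu>"

lemma run_Skip: "run w adj t (Some (Skip, m)) = return_pmf (Some (Skip, m))"
  by (induction t) (simp_all add: bind_return_pmf)

lemma run_None: "run w adj t None = return_pmf None"
  by (induction t) (simp_all add: bind_return_pmf)

lemma run_add: "run w adj (s + t) x = bind_pmf (run w adj s x) (run w adj t)"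
proof (induction s arbitrary: x)
  case 0
  show ?case by (simp add: bind_return_pmf)
next
  case (Suc s)
  then have "run w adj (s + t) = (\<lambda>x. bind_pmf (run w adj s x) (run w adj t))"
    by (rule ext)
  then show ?case by (simp add: bind_assoc_pmf)
qed

lemma run_mono:
  assumes "set_pmf (run w adj s x) \<subseteq> halted" and "s \<le> t"
  shows "run w adj t x = run w adj s x"
proof -
  have "run w adj t x = bind_pmf (run w adj s x) (run w adj (t - s))"
    using run_add[of w adj s "t - s" x] assms(2) by simp
  also have "\<dots> = bind_pmf (run w adj s x) return_pmf"
    by (rule bind_pmf_cong) (use assms(1) in \<open>auto simp: halted_def run_Skip\<close>)
  finally show ?thesis by (simp add: bind_return_pmf')
qed

lemma computes_halted:
  "computes w adj c m t \<mu> \<Longrightarrow> set_pmf (run w adj t (Some (c, m))) \<subseteq> halted"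
  by (auto simp: computes_def halted_def)

lemma computes_mono: "computes w adj c m s \<mu> \<Longrightarrow> s \<le> t \<Longrightarrow> computes w adj c m t \<mu>"
  using run_mono[OF computes_halted, of w adj c m s \<mu> t] by (simp add: computes_def)

text \<open>The additional step discards the finished \<open>Skip\<close>. Outcomes on which
  \<open>c1\<close> stops early start \<open>c2\<close> early; since \<open>c2\<close> then also
  halts early and halting is absorbing, the distribution at the common time is unaffected.\<close>

lemma run_Seq:
  assumes "set_pmf (run w adj t1 (Some (c1, m))) \<subseteq> halted"
    and "\<And>m'. Some (Skip, m') \<in> set_pmf (run w adj t1 (Some (c1, m))) \<Longrightarrow>
      set_pmf (run w adj t2 (Some (c2, m'))) \<subseteq> halted"
  shows "run w adj (t1 + 1 + t2) (Some (Seq c1 c2, m)) =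
    bind_pmf (run w adj t1 (Some (c1, m))) (\<lambda>x. run w adj t2 (Some (c2, snd (the x))))"
  using assms
proof (induction t1 arbitrary: c1 m)
  case 0
  then have "c1 = Skip" by (auto simp: halted_def)
  then show ?case by (simp add: bind_return_pmf)
next
  case (Suc t1)
  show ?case
  proof (cases "c1 = Skip")
    case True
    have "set_pmf (run w adj t2 (Some (c2, m))) \<subseteq> halted"
      using Suc.prems(2)[of m] True by (simp add: run_Skip bind_return_pmf)
    then have "run w adj (Suc t1 + t2) (Some (c2, m)) = run w adj t2 (Some (c2, m))"
      by (rule run_mono) simp
    then show ?thesis
      using True run_Skip[of w adj "Suc t1" m] by (simp add: bind_return_pmf)
  next
    case False
    let ?lift = "map_option (\<lambda>(c, m'). (Seq c c2, m'))"
    have "run w adj (Suc t1 + 1 + t2) (Some (Seq c1 c2, m)) =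
        bind_pmf (step w adj c1 m) (\<lambda>x. run w adj (t1 + 1 + t2) (?lift x))"
      using False by (simp add: bind_map_pmf)
    also have "\<dots> = bind_pmf (step w adj c1 m)
        (\<lambda>x. bind_pmf (run w adj t1 x) (\<lambda>x. run w adj t2 (Some (c2, snd (the x)))))"
    proof (rule bind_pmf_cong[OF refl])
      fix x assume x: "x \<in> set_pmf (step w adj c1 m)"
      have sub: "set_pmf (run w adj t1 x) \<subseteq> set_pmf (run w adj (Suc t1) (Some (c1, m)))"
        using x by auto
      have "x \<noteq> None"
      proof
        assume "x = None"
        with sub Suc.prems(1) have "None \<in> halted" by (auto simp: run_None)
        then show False by (simp add: halted_def)
      qed
      then obtain c m' where "x = Some (c, m')" by auto
      moreover from this have "run w adj (t1 + 1 + t2) (Some (Seq c c2, m')) =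
          bind_pmf (run w adj t1 (Some (c, m'))) (\<lambda>x. run w adj t2 (Some (c2, snd (the x))))"
        by (intro Suc.IH) (use Suc.prems sub in blast)+
      ultimately show "run w adj (t1 + 1 + t2) (?lift x) =
          bind_pmf (run w adj t1 x) (\<lambda>x. run w adj t2 (Some (c2, snd (the x))))"
        by (simp only: option.map prod.case)
    qed
    also have "\<dots> = bind_pmf (run w adj (Suc t1) (Some (c1, m)))
        (\<lambda>x. run w adj t2 (Some (c2, snd (the x))))"
      by (simp add: bind_assoc_pmf)
    finally show ?thesis .
  qed
qed

text \<open>Intermediate memories are parametrised as \<open>F x\<close> so that the continuation
  \<open>\<nu>\<close> may depend on the random value \<open>x\<close> without decoding it from
  memory.\<close>

lemma computes_Seq:
  assumes "computes w adj c1 m t1 (map_pmf F p)"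
    and "\<And>x. x \<in> set_pmf p \<Longrightarrow> computes w adj c2 (F x) t2 (\<nu> x)"
  shows "computes w adj (Seq c1 c2) m (t1 + 1 + t2) (bind_pmf p \<nu>)"
proof -
  have run1: "run w adj t1 (Some (c1, m)) = map_pmf (\<lambda>x. Some (Skip, F x)) p"
    using assms(1) by (simp add: computes_def map_pmf_comp)
  have "run w adj (t1 + 1 + t2) (Some (Seq c1 c2, m)) =
      bind_pmf (run w adj t1 (Some (c1, m))) (\<lambda>x. run w adj t2 (Some (c2, snd (the x))))"
  proof (rule run_Seq)
    show "set_pmf (run w adj t2 (Some (c2, m'))) \<subseteq> halted"
      if "Some (Skip, m') \<in> set_pmf (run w adj t1 (Some (c1, m)))" for m'
      using that run1 computes_halted[OF assms(2)] by auto
  qed (rule computes_halted[OF assms(1)])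
  also have "\<dots> = bind_pmf p (\<lambda>x. run w adj t2 (Some (c2, F x)))"
    by (simp add: run1 bind_map_pmf)
  also have "\<dots> = bind_pmf p (\<lambda>x. map_pmf (\<lambda>m'. Some (Skip, m')) (\<nu> x))"
    by (rule bind_pmf_cong) (use assms(2) in \<open>auto simp: computes_def\<close>)
  finally show ?thesis by (simp add: computes_def map_bind_pmf)
qed

lemma computes_Seq_return:
  assumes "computes w adj c1 m t1 (return_pmf m')" and "computes w adj c2 m' t2 \<mu>"
  shows "computes w adj (Seq c1 c2) m (t1 + 1 + t2) \<mu>"
  using computes_Seq[of w adj c1 m t1 "\<lambda>_. m'" "return_pmf ()" c2 t2 "\<lambda>_. \<mu>"] assms
  by (simp add: bind_return_pmf)

lemma computes_Seq_map:
  assumes "computes w adj c1 m t1 (map_pmf F p)"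
    and "\<And>x. x \<in> set_pmf p \<Longrightarrow> computes w adj c2 (F x) t2 (return_pmf (G x))"
  shows "computes w adj (Seq c1 c2) m (t1 + 1 + t2) (map_pmf G p)"
  using computes_Seq[OF assms] by (simp add: map_pmf_def)

lemma computes_Skip: "computes w adj Skip m 0 (return_pmf m)"
  by (simp add: computes_def)

lemma computes_Store:
  assumes "eval w m e1 = Some a" "eval w m e2 = Some x" "a < length m" "m' = m[a := x]"
  shows "computes w adj (Store e1 e2) m 1 (return_pmf m')"
  using assms by (simp add: computes_def bind_return_pmf)

lemma computes_Rand:
  assumes "eval w m e1 = Some a" "eval w m e2 = Some b" "a < length m" "0 < b"
  shows "computes w adj (Rand e1 e2) m 1 (map_pmf (\<lambda>x. m[a := x]) (pmf_of_set {..<b}))"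
proof -
  have "run w adj 0 = return_pmf" by (rule ext) simp
  then show ?thesis
    using assms by (simp add: computes_def bind_return_pmf' map_pmf_comp)
qed

lemma computes_Query:
  assumes "eval w m e1 = Some a" "eval w m e2 = Some v" "eval w m e3 = Some i"
    "v < length adj" "i < length (adj ! v)" "adj ! v ! i < 2 ^ w" "a < length m"
    "m' = m[a := adj ! v ! i]"
  shows "computes w adj (Query e1 e2 e3) m 1 (return_pmf m')"
  using assms by (simp add: computes_def bind_return_pmf)

lemma computes_Cond:
  assumes "eval w m e = Some x" "computes w adj (if x \<noteq> 0 then c1 else c2) m t \<mu>"
  shows "computes w adj (Cond e c1 c2) m (t + 1) \<mu>"
  using assms by (simp add: computes_def bind_return_pmf)

lemma computes_While_False:
  assumes "eval w m e = Some 0"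
  shows "computes w adj (While e c) m 2 (return_pmf m)"
  using assms by (simp add: computes_def bind_return_pmf numeral_2_eq_2)

lemma computes_While_True:
  assumes "eval w m e = Some x" "x \<noteq> 0" "computes w adj (Seq c (While e c)) m t \<mu>"
  shows "computes w adj (While e c) m (t + 2) \<mu>"
  using assms by (simp add: computes_def bind_return_pmf)

primrec iterate_pmf :: "nat \<Rightarrow> ('a \<Rightarrow> 'a pmf) \<Rightarrow> 'a \<Rightarrow> 'a pmf" where
  "iterate_pmf 0 f x = return_pmf x"
| "iterate_pmf (Suc k) f x = bind_pmf (f x) (iterate_pmf k f)"

lemma iterate_pmf_invariant:
  assumes "\<And>x y. I x \<Longrightarrow> y \<in> set_pmf (f x) \<Longrightarrow> I y"
  shows "I x \<Longrightarrow> y \<in> set_pmf (iterate_pmf k f x) \<Longrightarrow> I y"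
  by (induction k arbitrary: x) (auto dest: assms)

text \<open>This turns loops into Markov chains: memory is a function \<open>mm\<close> of the
  counter and an abstract state. Each pass pays 3 extra steps (unfolding \<open>While\<close>,
  deciding the guard, discarding \<open>Skip\<close>), and leaving the loop costs 2.\<close>

lemma computes_countdown:
  assumes guard: "\<And>k x. I x \<Longrightarrow> eval w (mm k x) e = Some k"
    and body: "\<And>k x. I x \<Longrightarrow> k < N \<Longrightarrow> computes w adj c (mm (Suc k) x) t (map_pmf (mm k) (f x))"
    and inv: "\<And>x y. I x \<Longrightarrow> y \<in> set_pmf (f x) \<Longrightarrow> I y"
  shows "I x \<Longrightarrow> k \<le> N \<Longrightarrow>
    computes w adj (While e c) (mm k x) (k * (t + 3) + 2) (map_pmf (mm 0) (iterate_pmf k f x))"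
proof (induction k arbitrary: x)
  case 0
  then show ?case using computes_While_False[OF guard[of x 0], of adj c] by (simp add: numeral_2_eq_2)
next
  case (Suc k)
  have "computes w adj (Seq c (While e c)) (mm (Suc k) x) (t + 1 + (k * (t + 3) + 2))
      (bind_pmf (f x) (\<lambda>y. map_pmf (mm 0) (iterate_pmf k f y)))"
  proof (rule computes_Seq)
    show "computes w adj c (mm (Suc k) x) t (map_pmf (mm k) (f x))"
      by (rule body) (use Suc.prems in auto)
    show "computes w adj (While e c) (mm k y) (k * (t + 3) + 2) (map_pmf (mm 0) (iterate_pmf k f y))"
      if "y \<in> set_pmf (f x)" for y
      using Suc.IH[of y] Suc.prems inv that by simp
  qed
  from computes_While_True[OF guard[OF Suc.prems(1)] Suc_not_Zero this] show ?case
    unfolding iterate_pmf.simps map_bind_pmf by (rule computes_mono) (simp add: algebra_simps)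
qed

section \<open>The program\<close>

text \<open>Binary length stands in for the logarithm because the machine can compute it by halving,
  while \<open>n < 2 ^ bits n \<le> 2 * n\<close> for positive \<open>n\<close> serves both the
  error and the time bound.\<close>

fun bits :: "nat \<Rightarrow> nat" where
  "bits x = (if x = 0 then 0 else Suc (bits (x div 2)))"

declare bits.simps [simp del]

text \<open>Cells: 0 \<open>n\<close>, 1 \<open>d\<close>, 2 \<open>M\<close>, 3 \<open>bits n\<close>, 4 scratch for computing \<open>bits n\<close>, 5 current vertex of the
  walk, 6 random choice, 7 to 9 loop counters, 10 starting vertex, 11 hit flag, 12 verdict, and the table
  from 13 on. Scratch cells are reset to 0 after use, so that the memory at each loop head is a function
  of the loop state.\<close>

abbreviation "Var i \<equiv> Load (Const i)"
abbreviation "Assign i e \<equiv> Store (Const i) e"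
abbreviation "Decr i \<equiv> Assign i (Bin Sub (Var i) (Const 1))"
abbreviation "slot \<equiv> Bin Add (Const 13) (Bin Mod (Var 5) (Var 2))"

text \<open>One random number below \<open>2 * d\<close> is both the laziness coin and the neighbour
  index: values below \<open>d\<close> select a neighbour, the others mean staying put.\<close>

definition walk_com :: "nat \<Rightarrow> com" where
  "walk_com C =
    Seq (Assign 7 (Bin Mul (Const C) (Var 3)))
    (While (Var 7)
      (Seq (Rand (Const 6) (Bin Mul (Const 2) (Var 1)))
      (Seq (Cond (Bin Less (Var 6) (Var 1)) (Query (Const 5) (Var 5) (Var 6)) Skip)
      (Seq (Assign 6 (Const 0))
      (Decr 7)))))"

definition bits_com :: com where
  "bits_com =
    Seq (Assign 4 (Var 0))
    (While (Var 4)
      (Seq (Assign 4 (Bin Div (Var 4) (Const 2)))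
      (Assign 3 (Bin Add (Var 3) (Const 1)))))"

text \<open>On an expander a walk fills a given cell with probability at least
  \<open>1 / (4 * M)\<close>, so 404 = 4 * 101 leaves it unfilled with probability at most
  \<open>(1/2) ^ (101 * bits n)\<close>; the excess over 100 pays for the union over fewer than
  \<open>2 ^ bits n\<close> cells. Cell 10 is still 0 here, so the walks start at vertex 0.\<close>

definition fill_com :: "nat \<Rightarrow> com" where
  "fill_com C =
    Seq (Assign 8 (Bin Mul (Bin Mul (Const 404) (Var 2)) (Var 3)))
    (While (Var 8)
      (Seq (Assign 5 (Var 10))
      (Seq (walk_com C)
      (Seq (Store slot (Var 5))
      (Seq (Assign 5 (Const 0))
      (Decr 8))))))"

text \<open>With hit probability \<open>min M n / (2 * n)\<close>, the factor 216 = 2 * 108 makes a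
  round miss with probability at most \<open>(1/2) ^ (108 * bits n)\<close>; the 8 beyond 100 pay
  for the union over the rounds. The summand 1 repairs the rounding of the quotient, which is 0 for
  \<open>M > n\<close>.\<close>

definition round_com :: "nat \<Rightarrow> com" where
  "round_com C =
    Seq (Assign 8 (Bin Mul (Bin Mul (Const 216) (Var 3)) (Bin Add (Bin Div (Var 0) (Var 2)) (Const 1))))
    (While (Var 8)
      (Seq (Assign 5 (Var 10))
      (Seq (walk_com C)
      (Seq (Cond (Bin Eq (Load slot) (Var 5)) (Assign 11 (Const 1)) Skip)
      (Seq (Assign 5 (Const 0))
      (Decr 8))))))"

text \<open>On two components a round leaves verdict 1 standing with probability at most one half,
  which fixes the number of rounds. The verdict can only change to 2, never back.\<close>

definition test_com :: "nat \<Rightarrow> com" where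
  "test_com C =
    Seq (Assign 9 (Bin Mul (Const 100) (Var 3)))
    (While (Var 9)
      (Seq (Rand (Const 10) (Var 0))
      (Seq (round_com C)
      (Seq (Cond (Var 11) Skip (Assign 12 (Const 2)))
      (Seq (Assign 11 (Const 0))
      (Seq (Assign 10 (Const 0))
      (Decr 9)))))))"

definition decide_com :: "nat \<Rightarrow> com" where
  "decide_com C =
    Seq bits_com
    (Seq (fill_com C)
    (Seq (Assign 12 (Const 1))
    (Seq (test_com C)
    (Assign 0 (Var 12)))))"

text \<open>Costs as delivered by the sequencing and loop rules. A walk step has a body of 8 steps
  and loop overhead 3; 4 = 1 + 1 + 2 pays for setting the counter, passing on to the loop and
  leaving it.\<close>

definition walk_steps :: "nat \<Rightarrow> nat \<Rightarrow> nat" where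
  "walk_steps C n = 11 * (C * bits n) + 4"

definition fill_steps :: "nat \<Rightarrow> nat \<Rightarrow> nat \<Rightarrow> nat" where
  "fill_steps C n M = 404 * M * bits n * (walk_steps C n + 11) + 4"

definition probe_count :: "nat \<Rightarrow> nat \<Rightarrow> nat" where
  "probe_count n M = 216 * bits n * (n div M + 1)"

definition round_steps :: "nat \<Rightarrow> nat \<Rightarrow> nat \<Rightarrow> nat" where
  "round_steps C n M = probe_count n M * (walk_steps C n + 12) + 4"

definition test_steps :: "nat \<Rightarrow> nat \<Rightarrow> nat \<Rightarrow> nat" where
  "test_steps C n M = 100 * bits n * (round_steps C n M + 14) + 4"

definition decide_steps :: "nat \<Rightarrow> nat \<Rightarrow> nat \<Rightarrow> nat" where
  "decide_steps C n M = 6 * bits n + fill_steps C n M + test_steps C n M + 12"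

text \<open>The word-size assumptions ensure that reduction modulo \<open>2 ^ w\<close> never
  changes a value, so machine arithmetic is arithmetic on naturals. 1024 covers all literals other
  than \<open>C\<close>.\<close>

locale adjacency_input =
  fixes w :: nat and adj :: "nat list list" and n d M C :: nat
  assumes length_adj: "length adj = n"
    and length_nth_adj: "v < n \<Longrightarrow> length (adj ! v) = d"
    and nth_nth_adj: "v < n \<Longrightarrow> i < d \<Longrightarrow> adj ! v ! i < n"
    and n_pos: "0 < n" and d_pos: "0 < d" and M_pos: "0 < M"
    and w_consts: "(1024::nat) \<le> 2 ^ w" "C < 2 ^ w"
    and w_input: "n < 2 ^ w" "2 * d < 2 ^ w" "13 + M < 2 ^ w"
    and w_counters: "C * bits n < 2 ^ w" "404 * M * bits n < 2 ^ w"
      "216 * bits n * (n div M + 1) < 2 ^ w" "100 * bits n < 2 ^ w"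
begin

definition mem :: "nat \<Rightarrow> nat \<Rightarrow> nat \<Rightarrow> nat \<Rightarrow> nat \<Rightarrow> nat \<Rightarrow> nat \<Rightarrow> nat \<Rightarrow> nat \<Rightarrow> nat \<Rightarrow> memory \<Rightarrow> memory" where
  "mem l x u r i j k v h q tbl = [n, d, M, l, x, u, r, i, j, k, v, h, q] @ tbl"

lemma mem_nth [simp]:
  "mem l x u r i j k v h q tbl ! 0 = n"
  "mem l x u r i j k v h q tbl ! Suc 0 = d"
  "mem l x u r i j k v h q tbl ! 2 = M"
  "mem l x u r i j k v h q tbl ! 3 = l"
  "mem l x u r i j k v h q tbl ! 4 = x"
  "mem l x u r i j k v h q tbl ! 5 = u"
  "mem l x u r i j k v h q tbl ! 6 = r"
  "mem l x u r i j k v h q tbl ! 7 = i"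
  "mem l x u r i j k v h q tbl ! 8 = j"
  "mem l x u r i j k v h q tbl ! 9 = k"
  "mem l x u r i j k v h q tbl ! 10 = v"
  "mem l x u r i j k v h q tbl ! 11 = h"
  "mem l x u r i j k v h q tbl ! 12 = q"
  "mem l x u r i j k v h q tbl ! (13 + a) = tbl ! a"
  by (simp_all add: mem_def numeral_eq_Suc)

lemma mem_update [simp]:
  "(mem l x u r i j k v h q tbl)[3 := y] = mem y x u r i j k v h q tbl"
  "(mem l x u r i j k v h q tbl)[4 := y] = mem l y u r i j k v h q tbl"
  "(mem l x u r i j k v h q tbl)[5 := y] = mem l x y r i j k v h q tbl"
  "(mem l x u r i j k v h q tbl)[6 := y] = mem l x u y i j k v h q tbl"
  "(mem l x u r i j k v h q tbl)[7 := y] = mem l x u r y j k v h q tbl"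
  "(mem l x u r i j k v h q tbl)[8 := y] = mem l x u r i y k v h q tbl"
  "(mem l x u r i j k v h q tbl)[9 := y] = mem l x u r i j y v h q tbl"
  "(mem l x u r i j k v h q tbl)[10 := y] = mem l x u r i j k y h q tbl"
  "(mem l x u r i j k v h q tbl)[11 := y] = mem l x u r i j k v y q tbl"
  "(mem l x u r i j k v h q tbl)[12 := y] = mem l x u r i j k v h y tbl"
  "(mem l x u r i j k v h q tbl)[13 + a := y] = mem l x u r i j k v h q (tbl[a := y])"
  by (simp_all add: mem_def numeral_eq_Suc)

lemma length_mem [simp]: "length (mem l x u r i j k v h q tbl) = 13 + length tbl"
  by (simp add: mem_def)

lemma w_pos [simp]: "0 < w"
  using w_consts(1) by (cases w) auto

lemma less_word [simp]:
  "a \<le> 1024 - 1 \<Longrightarrow> a < 2 ^ w"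
  "a < n \<Longrightarrow> a < 2 ^ w"
  "a < M \<Longrightarrow> 13 + a < 2 ^ w"
  "a < M \<Longrightarrow> a < 2 ^ w"
  using w_consts w_input by linarith+

lemma computes_Assign:
  assumes "eval w m e = Some x" "a < 1024" "a < length m" "m' = m[a := x]"
  shows "computes w adj (Assign a e) m 1 (return_pmf m')"
  using assms by (intro computes_Store) auto

lemma computes_Rand_cell:
  assumes "eval w m e = Some b" "a < 1024" "a < length m" "0 < b"
  shows "computes w adj (Rand (Const a) e) m 1 (map_pmf (\<lambda>x. m[a := x]) (pmf_of_set {..<b}))"
  using assms by (intro computes_Rand) auto

section \<open>Distributions realised by the program fragments\<close>

definition lazy_step :: "nat \<Rightarrow> nat pmf" where
  "lazy_step u = map_pmf (\<lambda>r. if r < d then adj ! u ! r else u) (pmf_of_set {..<2 * d})"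

lemma set_lazy_step: "set_pmf (lazy_step u) \<subseteq> insert u ((!) (adj ! u) ` {..<d})"
  using d_pos by (auto simp: lazy_step_def set_pmf_of_set lessThan_empty_iff)

lemma lazy_step_less: "u < n \<Longrightarrow> v \<in> set_pmf (lazy_step u) \<Longrightarrow> v < n"
  using set_lazy_step[of u] nth_nth_adj by auto

definition walk :: "nat \<Rightarrow> nat pmf" where
  "walk = iterate_pmf (C * bits n) lazy_step"

lemma walk_less: "u < n \<Longrightarrow> v \<in> set_pmf (walk u) \<Longrightarrow> v < n"
  unfolding walk_def by (rule iterate_pmf_invariant[of "\<lambda>u. u < n"]) (auto dest: lazy_step_less)

abbreviation "walk_time \<equiv> walk_steps C n"

lemma computes_walk:
  assumes "u < n"
  shows "computes w adj (walk_com C) (mem (bits n) 0 u 0 0 j k v h q tbl) walk_time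
    (map_pmf (\<lambda>u. mem (bits n) 0 u 0 0 j k v h q tbl) (walk u))"
proof -
  let ?mm = "\<lambda>i u. mem (bits n) 0 u 0 i j k v h q tbl"
  let ?rest = "Seq (Cond (Bin Less (Var 6) (Var 1)) (Query (Const 5) (Var 5) (Var 6)) Skip)
    (Seq (Assign 6 (Const 0)) (Decr 7))"
  have body: "computes w adj (Seq (Rand (Const 6) (Bin Mul (Const 2) (Var 1))) ?rest) (?mm (Suc i) u) (1 + 1 + (1 + 1 + 1 + (1 + 1 + 1)))
      (map_pmf (?mm i) (lazy_step u))" if u: "u < n" and i: "i < C * bits n" for i u
    unfolding lazy_step_def map_pmf_comp
  proof (rule computes_Seq_map)
    show "computes w adj (Rand (Const 6) (Bin Mul (Const 2) (Var 1))) (?mm (Suc i) u) 1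
       (map_pmf (\<lambda>r. mem (bits n) 0 u r (Suc i) j k v h q tbl) (pmf_of_set {..<2 * d}))"
      using computes_Rand_cell[of "?mm (Suc i) u" "Bin Mul (Const 2) (Var 1)" "2 * d" 6] d_pos w_input
      by simp
    fix r assume "r \<in> set_pmf (pmf_of_set {..<2 * d})"
    then have r: "r < 2 * d" using d_pos by (simp add: set_pmf_of_set lessThan_empty_iff)
    let ?u = "if r < d then adj ! u ! r else u"
    show "computes w adj ?rest (mem (bits n) 0 u r (Suc i) j k v h q tbl) (1 + 1 + 1 + (1 + 1 + 1))
        (return_pmf (?mm i ?u))"
    proof (rule computes_Seq_return)
      have "computes w adj (if of_bool (r < d) \<noteq> (0::nat) then Query (Const 5) (Var 5) (Var 6) else Skip)
          (mem (bits n) 0 u r (Suc i) j k v h q tbl) 1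
          (return_pmf (mem (bits n) 0 ?u r (Suc i) j k v h q tbl))"
      proof (cases "r < d")
        case True
        then show ?thesis
          using u by (auto intro!: computes_Query[unfolded One_nat_def] simp: length_adj length_nth_adj nth_nth_adj)
      next
        case False
        then show ?thesis
          using computes_mono[OF computes_Skip] by simp
      qed
      then show "computes w adj (Cond (Bin Less (Var 6) (Var 1)) (Query (Const 5) (Var 5) (Var 6)) Skip)
          (mem (bits n) 0 u r (Suc i) j k v h q tbl) (1 + 1)
          (return_pmf (mem (bits n) 0 ?u r (Suc i) j k v h q tbl))"
        by (rule computes_Cond[rotated]) simp
      show "computes w adj (Seq (Assign 6 (Const 0)) (Decr 7)) (mem (bits n) 0 ?u r (Suc i) j k v h q tbl)
          (1 + 1 + 1) (return_pmf (?mm i ?u))"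
        using i w_counters by (intro computes_Seq_return computes_Assign) (auto intro: refl)
    qed
  qed
  have "computes w adj (While (Var 7) (Seq (Rand (Const 6) (Bin Mul (Const 2) (Var 1))) ?rest))
      (?mm (C * bits n) u) (C * bits n * (1 + 1 + (1 + 1 + 1 + (1 + 1 + 1)) + 3) + 2)
      (map_pmf (?mm 0) (iterate_pmf (C * bits n) lazy_step u))"
    by (rule computes_countdown[where I = "\<lambda>u. u < n" and mm = ?mm and f = lazy_step,
          OF _ body _ assms order_refl]) (auto dest: lazy_step_less)
  moreover have "computes w adj (Assign 7 (Bin Mul (Const C) (Var 3))) (?mm 0 u) 1
      (return_pmf (?mm (C * bits n) u))"
    using w_consts w_counters by (intro computes_Assign) auto
  ultimately show ?thesis
    unfolding walk_com_def walk_def walk_steps_def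
    by (rule computes_mono[OF computes_Seq_return[rotated]]) simp
qed

text \<open>The sum \<open>bits x + l\<close> is invariant and equals the final content of cell 3;
  its bound by \<open>bits n\<close> keeps the counter within a word.\<close>

lemma computes_bits_loop:
  "bits x + l \<le> bits n \<Longrightarrow> x \<le> n \<Longrightarrow>
   computes w adj (While (Var 4) (Seq (Assign 4 (Bin Div (Var 4) (Const 2)))
      (Assign 3 (Bin Add (Var 3) (Const 1))))) (mem l x 0 0 0 0 0 0 0 0 tbl) (6 * bits x + 2)
      (return_pmf (mem (bits x + l) 0 0 0 0 0 0 0 0 0 tbl))"
proof (induction x arbitrary: l rule: less_induct)
  case (less x)
  let ?body = "Seq (Assign 4 (Bin Div (Var 4) (Const 2))) (Assign 3 (Bin Add (Var 3) (Const 1)))"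
  show ?case
  proof (cases "x = 0")
    case True
    then have "computes w adj (While (Var 4) ?body) (mem l x 0 0 0 0 0 0 0 0 tbl) 2
        (return_pmf (mem l x 0 0 0 0 0 0 0 0 tbl))"
      by (intro computes_While_False) simp
    with True show ?thesis by (simp add: bits.simps numeral_2_eq_2)
  next
    case False
    then have bx: "bits x = Suc (bits (x div 2))" by (simp add: bits.simps)
    have "Suc l < 2 ^ w" using less.prems(1) bx w_counters(4) by linarith
    have "x div 2 < 2 ^ w"
      using less.prems(2) w_input(1) by (meson div_le_dividend le_less_trans)
    have unrolled: "computes w adj (Seq ?body (While (Var 4) ?body)) (mem l x 0 0 0 0 0 0 0 0 tbl)
        (1 + 1 + 1 + 1 + (6 * bits (x div 2) + 2))
        (return_pmf (mem (bits (x div 2) + Suc l) 0 0 0 0 0 0 0 0 0 tbl))"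
    proof (rule computes_Seq_return)
      show "computes w adj ?body (mem l x 0 0 0 0 0 0 0 0 tbl) (1 + 1 + 1)
          (return_pmf (mem (Suc l) (x div 2) 0 0 0 0 0 0 0 0 tbl))"
      proof (rule computes_Seq_return)
        show "computes w adj (Assign 4 (Bin Div (Var 4) (Const 2))) (mem l x 0 0 0 0 0 0 0 0 tbl) 1
            (return_pmf (mem l (x div 2) 0 0 0 0 0 0 0 0 tbl))"
          using \<open>x div 2 < 2 ^ w\<close> by (intro computes_Assign) auto
        show "computes w adj (Assign 3 (Bin Add (Var 3) (Const 1))) (mem l (x div 2) 0 0 0 0 0 0 0 0 tbl) 1
            (return_pmf (mem (Suc l) (x div 2) 0 0 0 0 0 0 0 0 tbl))"
          using \<open>Suc l < 2 ^ w\<close> by (intro computes_Assign) auto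
      qed
      show "computes w adj (While (Var 4) ?body) (mem (Suc l) (x div 2) 0 0 0 0 0 0 0 0 tbl)
          (6 * bits (x div 2) + 2) (return_pmf (mem (bits (x div 2) + Suc l) 0 0 0 0 0 0 0 0 0 tbl))"
        using False less.prems bx by (intro less.IH) auto
    qed
    have "computes w adj (While (Var 4) ?body) (mem l x 0 0 0 0 0 0 0 0 tbl)
        (1 + 1 + 1 + 1 + (6 * bits (x div 2) + 2) + 2)
        (return_pmf (mem (bits (x div 2) + Suc l) 0 0 0 0 0 0 0 0 0 tbl))"
      by (rule computes_While_True[OF _ False unrolled]) simp
    then show ?thesis
      unfolding bx add_Suc add_Suc_right by (rule computes_mono) simp
  qed
qed

lemma computes_bits:
  "computes w adj bits_com (mem 0 0 0 0 0 0 0 0 0 0 tbl) (6 * bits n + 4)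
    (return_pmf (mem (bits n) 0 0 0 0 0 0 0 0 0 tbl))"
proof -
  have "computes w adj (Assign 4 (Var 0)) (mem 0 0 0 0 0 0 0 0 0 0 tbl) 1
      (return_pmf (mem 0 n 0 0 0 0 0 0 0 0 tbl))"
    by (intro computes_Assign) auto
  from computes_Seq_return[OF this computes_bits_loop[of n 0, unfolded add_0_right, OF order_refl order_refl]]
  show ?thesis
    unfolding bits_com_def by (rule computes_mono) simp
qed

definition fill :: "nat list \<Rightarrow> nat list pmf" where
  "fill tbl = map_pmf (\<lambda>u. tbl[u mod M := u]) (walk 0)"

abbreviation "fill_time \<equiv> fill_steps C n M"

lemma computes_fill:
  assumes "length tbl = M"
  shows "computes w adj (fill_com C) (mem (bits n) 0 0 0 0 0 0 0 0 0 tbl) fill_time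
    (map_pmf (mem (bits n) 0 0 0 0 0 0 0 0 0) (iterate_pmf (404 * M * bits n) fill tbl))"
proof -
  let ?mm = "\<lambda>j tbl. mem (bits n) 0 0 0 0 j 0 0 0 0 tbl"
  let ?tail = "Seq (Store slot (Var 5)) (Seq (Assign 5 (Const 0)) (Decr 8))"
  let ?body = "Seq (Assign 5 (Var 10)) (Seq (walk_com C) ?tail)"
  have body: "computes w adj ?body (?mm (Suc j) tbl) (1 + 1 + (walk_time + 1 + (1 + 1 + (1 + 1 + 1))))
      (map_pmf (?mm j) (fill tbl))" if len: "length tbl = M" and j: "j < 404 * M * bits n" for j tbl
    unfolding fill_def map_pmf_comp
  proof (rule computes_Seq_return)
    show "computes w adj (Assign 5 (Var 10)) (?mm (Suc j) tbl) 1 (return_pmf (?mm (Suc j) tbl))"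
      by (intro computes_Assign) auto
    show "computes w adj (Seq (walk_com C) ?tail) (?mm (Suc j) tbl) (walk_time + 1 + (1 + 1 + (1 + 1 + 1)))
        (map_pmf (\<lambda>u. ?mm j (tbl[u mod M := u])) (walk 0))"
    proof (rule computes_Seq_map[OF computes_walk[OF n_pos]])
      fix u assume "u \<in> set_pmf (walk 0)"
      then have u: "u < n" using walk_less n_pos by blast
      show "computes w adj ?tail (mem (bits n) 0 u 0 0 (Suc j) 0 0 0 0 tbl) (1 + 1 + (1 + 1 + 1))
          (return_pmf (?mm j (tbl[u mod M := u])))"
      proof (rule computes_Seq_return)
        show "computes w adj (Store slot (Var 5)) (mem (bits n) 0 u 0 0 (Suc j) 0 0 0 0 tbl) 1
            (return_pmf (mem (bits n) 0 u 0 0 (Suc j) 0 0 0 0 (tbl[u mod M := u])))"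
          using u M_pos len by (intro computes_Store[where a = "13 + u mod M" and x = u]) auto
        show "computes w adj (Seq (Assign 5 (Const 0)) (Decr 8))
            (mem (bits n) 0 u 0 0 (Suc j) 0 0 0 0 (tbl[u mod M := u])) (1 + 1 + 1)
            (return_pmf (?mm j (tbl[u mod M := u])))"
          using j w_counters by (intro computes_Seq_return computes_Assign) (auto intro: refl)
      qed
    qed
  qed
  have "computes w adj (While (Var 8) ?body) (?mm (404 * M * bits n) tbl)
      (404 * M * bits n * (1 + 1 + (walk_time + 1 + (1 + 1 + (1 + 1 + 1))) + 3) + 2)
      (map_pmf (?mm 0) (iterate_pmf (404 * M * bits n) fill tbl))"
    by (rule computes_countdown[where I = "\<lambda>tbl. length tbl = M" and mm = ?mm and f = fill,
          OF _ body _ assms order_refl])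
      (auto simp: fill_def)
  moreover have "computes w adj (Assign 8 (Bin Mul (Bin Mul (Const 404) (Var 2)) (Var 3))) (?mm 0 tbl) 1
      (return_pmf (?mm (404 * M * bits n) tbl))"
    using w_counters by (intro computes_Assign) (auto simp: mod_mult_left_eq)
  ultimately show ?thesis
    unfolding fill_com_def fill_steps_def
    by (rule computes_mono[OF computes_Seq_return[rotated]]) simp
qed

definition probe :: "nat list \<Rightarrow> nat \<Rightarrow> nat \<Rightarrow> nat pmf" where
  "probe tbl v h = map_pmf (\<lambda>u. if tbl ! (u mod M) = u then 1 else h) (walk v)"

abbreviation "probes \<equiv> probe_count n M"

abbreviation "round_time \<equiv> round_steps C n M"

lemma computes_round:
  assumes len: "length tbl = M" and v: "v < n"
  shows "computes w adj (round_com C) (mem (bits n) 0 0 0 0 0 k v 0 q tbl) round_time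
    (map_pmf (\<lambda>h. mem (bits n) 0 0 0 0 0 k v h q tbl) (iterate_pmf probes (probe tbl v) 0))"
proof -
  let ?mm = "\<lambda>j h. mem (bits n) 0 0 0 0 j k v h q tbl"
  let ?cond = "Cond (Bin Eq (Load slot) (Var 5)) (Assign 11 (Const 1)) Skip"
  let ?tail = "Seq ?cond (Seq (Assign 5 (Const 0)) (Decr 8))"
  let ?body = "Seq (Assign 5 (Var 10)) (Seq (walk_com C) ?tail)"
  have body: "computes w adj ?body (?mm (Suc j) h) (1 + 1 + (walk_time + 1 + (1 + 1 + 1 + (1 + 1 + 1))))
      (map_pmf (?mm j) (probe tbl v h))" if j: "j < probes" for j h
    unfolding probe_def map_pmf_comp
  proof (rule computes_Seq_return)
    show "computes w adj (Assign 5 (Var 10)) (?mm (Suc j) h) 1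
        (return_pmf (mem (bits n) 0 v 0 0 (Suc j) k v h q tbl))"
      by (intro computes_Assign) auto
    show "computes w adj (Seq (walk_com C) ?tail) (mem (bits n) 0 v 0 0 (Suc j) k v h q tbl)
        (walk_time + 1 + (1 + 1 + 1 + (1 + 1 + 1)))
        (map_pmf (\<lambda>u. ?mm j (if tbl ! (u mod M) = u then 1 else h)) (walk v))"
    proof (rule computes_Seq_map[OF computes_walk[OF v]])
      fix u assume "u \<in> set_pmf (walk v)"
      then have u: "u < n" using walk_less v by blast
      let ?h = "if tbl ! (u mod M) = u then 1 else h"
      show "computes w adj ?tail (mem (bits n) 0 u 0 0 (Suc j) k v h q tbl) (1 + 1 + 1 + (1 + 1 + 1))
          (return_pmf (?mm j ?h))"
      proof (rule computes_Seq_return)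
        have "computes w adj (if of_bool (tbl ! (u mod M) = u) \<noteq> (0::nat) then Assign 11 (Const 1) else Skip)
            (mem (bits n) 0 u 0 0 (Suc j) k v h q tbl) 1
            (return_pmf (mem (bits n) 0 u 0 0 (Suc j) k v ?h q tbl))"
          using computes_mono[OF computes_Skip]
          by (auto intro!: computes_Assign[unfolded One_nat_def])
        then show "computes w adj ?cond (mem (bits n) 0 u 0 0 (Suc j) k v h q tbl) (1 + 1)
            (return_pmf (mem (bits n) 0 u 0 0 (Suc j) k v ?h q tbl))"
          by (rule computes_Cond[rotated]) (use u M_pos len in simp)
        show "computes w adj (Seq (Assign 5 (Const 0)) (Decr 8))
            (mem (bits n) 0 u 0 0 (Suc j) k v ?h q tbl) (1 + 1 + 1) (return_pmf (?mm j ?h))"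
          using j w_counters by (intro computes_Seq_return computes_Assign) (auto simp: probe_count_def intro: refl)
      qed
    qed
  qed
  have "computes w adj (While (Var 8) ?body) (?mm probes 0)
      (probes * (1 + 1 + (walk_time + 1 + (1 + 1 + 1 + (1 + 1 + 1))) + 3) + 2)
      (map_pmf (?mm 0) (iterate_pmf probes (probe tbl v) 0))"
    by (rule computes_countdown[where I = "\<lambda>_. True" and mm = ?mm and f = "probe tbl v",
          OF _ body _ _ order_refl]) auto
  moreover have "computes w adj
      (Assign 8 (Bin Mul (Bin Mul (Const 216) (Var 3)) (Bin Add (Bin Div (Var 0) (Var 2)) (Const 1))))
      (?mm 0 0) 1 (return_pmf (?mm probes 0))"
    using w_counters by (intro computes_Assign) (auto simp: probe_count_def mod_mult_left_eq mod_mult_right_eq mod_simps)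
  ultimately show ?thesis
    unfolding round_com_def round_steps_def
    by (rule computes_mono[OF computes_Seq_return[rotated]]) simp
qed

definition test :: "nat list \<Rightarrow> nat \<Rightarrow> nat pmf" where
  "test tbl q = bind_pmf (pmf_of_set {..<n})
    (\<lambda>v. map_pmf (\<lambda>h. if h = 0 then 2 else q) (iterate_pmf probes (probe tbl v) 0))"

abbreviation "test_time \<equiv> test_steps C n M"

lemma computes_test:
  assumes len: "length tbl = M"
  shows "computes w adj (test_com C) (mem (bits n) 0 0 0 0 0 0 0 0 q tbl) test_time
    (map_pmf (\<lambda>q. mem (bits n) 0 0 0 0 0 0 0 0 q tbl) (iterate_pmf (100 * bits n) (test tbl) q))"
proof -
  let ?mm = "\<lambda>k q. mem (bits n) 0 0 0 0 0 k 0 0 q tbl"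
  let ?reset = "Seq (Assign 11 (Const 0)) (Seq (Assign 10 (Const 0)) (Decr 9))"
  let ?cond = "Cond (Var 11) Skip (Assign 12 (Const 2))"
  let ?body = "Seq (Rand (Const 10) (Var 0)) (Seq (round_com C) (Seq ?cond ?reset))"
  have body: "computes w adj ?body (?mm (Suc k) q) (1 + 1 + (round_time + 1 + (1 + 1 + 1 + (1 + 1 + (1 + 1 + 1)))))
      (map_pmf (?mm k) (test tbl q))" if k: "k < 100 * bits n" for k q
    unfolding test_def map_bind_pmf map_pmf_comp
  proof (rule computes_Seq)
    show "computes w adj (Rand (Const 10) (Var 0)) (?mm (Suc k) q) 1
        (map_pmf (\<lambda>v. mem (bits n) 0 0 0 0 0 (Suc k) v 0 q tbl) (pmf_of_set {..<n}))"
      using computes_Rand_cell[of "?mm (Suc k) q" "Var 0" n 10] n_pos by simp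
    fix v assume "v \<in> set_pmf (pmf_of_set {..<n})"
    then have v: "v < n" using n_pos by (simp add: set_pmf_of_set lessThan_empty_iff)
    let ?p = "iterate_pmf probes (probe tbl v) 0"
    show "computes w adj (Seq (round_com C) (Seq ?cond ?reset)) (mem (bits n) 0 0 0 0 0 (Suc k) v 0 q tbl)
        (round_time + 1 + (1 + 1 + 1 + (1 + 1 + (1 + 1 + 1))))
        (map_pmf (\<lambda>h. ?mm k (if h = 0 then 2 else q)) ?p)"
    proof (rule computes_Seq_map[OF computes_round[OF len v]])
      fix h :: nat
      let ?q = "if h = 0 then 2 else q"
      show "computes w adj (Seq ?cond ?reset) (mem (bits n) 0 0 0 0 0 (Suc k) v h q tbl)
          (1 + 1 + 1 + (1 + 1 + (1 + 1 + 1))) (return_pmf (?mm k ?q))"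
      proof (rule computes_Seq_return)
        have "computes w adj (if h \<noteq> 0 then Skip else Assign 12 (Const 2))
            (mem (bits n) 0 0 0 0 0 (Suc k) v h q tbl) 1
            (return_pmf (mem (bits n) 0 0 0 0 0 (Suc k) v h ?q tbl))"
          using computes_mono[OF computes_Skip]
          by (auto intro!: computes_Assign[unfolded One_nat_def])
        then show "computes w adj ?cond (mem (bits n) 0 0 0 0 0 (Suc k) v h q tbl) (1 + 1)
            (return_pmf (mem (bits n) 0 0 0 0 0 (Suc k) v h ?q tbl))"
          by (rule computes_Cond[rotated]) simp
        show "computes w adj ?reset (mem (bits n) 0 0 0 0 0 (Suc k) v h ?q tbl) (1 + 1 + (1 + 1 + 1))
            (return_pmf (?mm k ?q))"
          using k w_counters by (intro computes_Seq_return computes_Assign) (auto intro: refl)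
      qed
    qed
  qed
  have "computes w adj (While (Var 9) ?body) (?mm (100 * bits n) q)
      (100 * bits n * (1 + 1 + (round_time + 1 + (1 + 1 + 1 + (1 + 1 + (1 + 1 + 1)))) + 3) + 2)
      (map_pmf (?mm 0) (iterate_pmf (100 * bits n) (test tbl) q))"
    by (rule computes_countdown[where I = "\<lambda>_. True" and mm = ?mm and f = "test tbl",
          OF _ body _ _ order_refl]) auto
  moreover have "computes w adj (Assign 9 (Bin Mul (Const 100) (Var 3))) (?mm 0 q) 1
      (return_pmf (?mm (100 * bits n) q))"
    using w_counters by (intro computes_Assign) auto
  ultimately show ?thesis
    unfolding test_com_def test_steps_def
    by (rule computes_mono[OF computes_Seq_return[rotated]]) simp
qed

definition decide :: "nat pmf" where
  "decide = bind_pmf (iterate_pmf (404 * M * bits n) fill (replicate M 0))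
    (\<lambda>tbl. iterate_pmf (100 * bits n) (test tbl) 1)"

abbreviation "decide_time \<equiv> decide_steps C n M"

lemma computes_decide:
  "computes w adj (decide_com C) (mem 0 0 0 0 0 0 0 0 0 0 (replicate M 0)) decide_time
    (bind_pmf (iterate_pmf (404 * M * bits n) fill (replicate M 0))
      (\<lambda>tbl. map_pmf (\<lambda>q. (mem (bits n) 0 0 0 0 0 0 0 0 q tbl)[0 := q])
         (iterate_pmf (100 * bits n) (test tbl) 1)))"
proof -
  let ?fill = "iterate_pmf (404 * M * bits n) fill (replicate M 0)"
  let ?test = "\<lambda>tbl. iterate_pmf (100 * bits n) (test tbl) 1"
  let ?tail = "Seq (Assign 12 (Const 1)) (Seq (test_com C) (Assign 0 (Var 12)))"
  have "computes w adj (Seq (fill_com C) ?tail) (mem (bits n) 0 0 0 0 0 0 0 0 0 (replicate M 0))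
      (fill_time + 1 + (1 + 1 + (test_time + 1 + 1)))
      (bind_pmf ?fill (\<lambda>tbl. map_pmf (\<lambda>q. (mem (bits n) 0 0 0 0 0 0 0 0 q tbl)[0 := q]) (?test tbl)))"
  proof (rule computes_Seq[OF computes_fill])
    fix tbl assume "tbl \<in> set_pmf ?fill"
    then have len: "length tbl = M"
      by (rule iterate_pmf_invariant[of "\<lambda>tbl. length tbl = M", rotated 2]) (auto simp: fill_def)
    show "computes w adj ?tail (mem (bits n) 0 0 0 0 0 0 0 0 0 tbl) (1 + 1 + (test_time + 1 + 1))
        (map_pmf (\<lambda>q. (mem (bits n) 0 0 0 0 0 0 0 0 q tbl)[0 := q]) (?test tbl))"
    proof (rule computes_Seq_return)
      show "computes w adj (Assign 12 (Const 1)) (mem (bits n) 0 0 0 0 0 0 0 0 0 tbl) 1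
          (return_pmf (mem (bits n) 0 0 0 0 0 0 0 0 1 tbl))"
        by (intro computes_Assign) auto
      show "computes w adj (Seq (test_com C) (Assign 0 (Var 12))) (mem (bits n) 0 0 0 0 0 0 0 0 1 tbl)
          (test_time + 1 + 1)
          (map_pmf (\<lambda>q. (mem (bits n) 0 0 0 0 0 0 0 0 q tbl)[0 := q]) (?test tbl))"
      proof (rule computes_Seq_map[OF computes_test[OF len]])
        show "computes w adj (Assign 0 (Var 12)) (mem (bits n) 0 0 0 0 0 0 0 0 q tbl) 1
            (return_pmf ((mem (bits n) 0 0 0 0 0 0 0 0 q tbl)[0 := q]))" for q
          by (intro computes_Assign) auto
      qed
    qed
  qed simp
  from computes_Seq_return[OF computes_bits this] show ?thesis
    unfolding decide_com_def by (rule computes_mono) (simp add: decide_steps_def)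
qed

text \<open>The passage from machine to probability: what remains to be analysed is the distribution
  \<open>decide\<close> of the verdict.\<close>

lemma run_decide:
  defines "result \<equiv> run w adj decide_time (Some (decide_com C, initial_memory w (13 + M) [n, d, M]))"
  shows "set_pmf result \<subseteq> halted"
    and "measure_pmf.prob result (halted_with r) = measure_pmf.prob decide {r}"
proof -
  have "initial_memory w (13 + M) [n, d, M] = mem 0 0 0 0 0 0 0 0 0 0 (replicate M 0)"
    using w_input by (simp add: initial_memory_def mem_def numeral_eq_Suc)
  then have *: "computes w adj (decide_com C) (initial_memory w (13 + M) [n, d, M]) decide_time
    (bind_pmf (iterate_pmf (404 * M * bits n) fill (replicate M 0))
      (\<lambda>tbl. map_pmf (\<lambda>q. (mem (bits n) 0 0 0 0 0 0 0 0 q tbl)[0 := q])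
         (iterate_pmf (100 * bits n) (test tbl) 1)))" (is "computes _ _ _ _ _ ?\<mu>")
    using computes_decide by simp
  show "set_pmf result \<subseteq> halted"
    unfolding result_def by (rule computes_halted[OF *])
  have map_eq: "map_pmf (\<lambda>m. m ! 0) ?\<mu> = decide"
    by (simp add: decide_def map_bind_pmf map_pmf_comp)
  have "measure_pmf.prob result (halted_with r) = measure_pmf.prob ?\<mu> {m. m ! 0 = r}"
  proof -
    have "result = map_pmf (\<lambda>m'. Some (Skip, m')) ?\<mu>"
      using * by (simp add: computes_def result_def)
    moreover have "(\<lambda>m'. Some (Skip, m')) -` halted_with r = {m. m \<noteq> [] \<and> m ! 0 = r}"
      by (auto simp: halted_with_def split: if_splits)
    ultimately have "measure_pmf.prob result (halted_with r) =
        measure_pmf.prob ?\<mu> {m. m \<noteq> [] \<and> m ! 0 = r}"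
      by (simp only: measure_map_pmf)
    \<comment> \<open>Every memory in the support has at least 13 cells, so the unspecified head of
      an empty list never matters.\<close>
    also have "\<dots> = measure_pmf.prob ?\<mu> {m. m ! 0 = r}"
      by (rule measure_pmf.finite_measure_eq_AE) (auto simp: AE_measure_pmf_iff mem_def)
    finally show ?thesis .
  qed
  also have "\<dots> = measure_pmf.prob decide {r}"
    unfolding map_eq[symmetric] measure_map_pmf vimage_def by simp
  finally show "measure_pmf.prob result (halted_with r) = measure_pmf.prob decide {r}" .
qed

end

section \<open>Probability bounds for iterated kernels\<close>

lemma prob_bind_pmf:
  "measure_pmf.prob (bind_pmf p f) X = measure_pmf.expectation p (\<lambda>x. measure_pmf.prob (f x) X)"
proof -
  have *: "measure_pmf.prob q X = pmf (map_pmf (\<lambda>x. x \<in> X) q) True" for q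
    by (simp add: pmf_map vimage_def)
  show ?thesis unfolding * map_bind_pmf pmf_bind ..
qed

text \<open>The affine form has two purposes: with \<open>a = 0\<close> failure probabilities of
  successive steps multiply, with \<open>b = 1\<close> the probability of a bad intermediate event
  is added.\<close>

lemma prob_bind_le:
  assumes "\<And>x. x \<in> set_pmf p \<Longrightarrow> measure_pmf.prob (f x) X \<le> a + b * indicator Y x"
  shows "measure_pmf.prob (bind_pmf p f) X \<le> a + b * measure_pmf.prob p Y"
proof -
  have "measure_pmf.prob (bind_pmf p f) X \<le> measure_pmf.expectation p (\<lambda>x. a + b * indicator Y x)"
    unfolding prob_bind_pmf
  proof (rule integral_mono_AE)
    show "integrable (measure_pmf p) (\<lambda>x. measure_pmf.prob (f x) X)"
      by (rule measure_pmf.integrable_const_bound[where B = 1]) auto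
    show "integrable (measure_pmf p) (\<lambda>x. a + b * indicator Y x)"
      by (auto intro!: integrable_real_indicator simp: measure_pmf.emeasure_eq_measure)
  qed (use assms in \<open>simp add: AE_measure_pmf_iff\<close>)
  also have "\<dots> = a + b * measure_pmf.prob p Y"
    by (subst Bochner_Integration.integral_add)
      (auto intro!: integrable_real_indicator simp: measure_pmf.emeasure_eq_measure)
  finally show ?thesis .
qed

lemma prob_bind_le_const:
  assumes "\<And>x. x \<in> set_pmf p \<Longrightarrow> measure_pmf.prob (f x) X \<le> a"
  shows "measure_pmf.prob (bind_pmf p f) X \<le> a"
  using prob_bind_le[of p f X a 0 UNIV] assms by simp

lemma prob_eq_0: "set_pmf p \<inter> X = {} \<Longrightarrow> measure_pmf.prob p X = 0"
  by (simp add: measure_pmf_zero_iff)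

text \<open>The bound \<open>\<delta>\<close> holds from every state outside \<open>G\<close>, so
  misses multiply although successive states are dependent. Instances of \<open>G\<close> are a
  filled cell, a raised hit flag and the verdict 2.\<close>

lemma prob_iterate_never_le:
  assumes inv: "\<And>x y. I x \<Longrightarrow> y \<in> set_pmf (f x) \<Longrightarrow> I y"
    and absorbing: "\<And>x. I x \<Longrightarrow> x \<in> G \<Longrightarrow> set_pmf (f x) \<subseteq> G"
    and miss: "\<And>x. I x \<Longrightarrow> x \<notin> G \<Longrightarrow> measure_pmf.prob (f x) (- G) \<le> \<delta>"
    and \<delta>: "0 \<le> \<delta>"
  shows "I x \<Longrightarrow> measure_pmf.prob (iterate_pmf k f x) (- G) \<le> \<delta> ^ k"
proof (induction k arbitrary: x)
  case 0
  show ?case by simp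
next
  case (Suc k)
  have stay: "measure_pmf.prob (iterate_pmf j f y) (- G) = 0" if "I y" "y \<in> G" for y j
  proof -
    have "z \<in> G" if "z \<in> set_pmf (iterate_pmf j f y)" for z
      using iterate_pmf_invariant[of "\<lambda>z. I z \<and> z \<in> G" f y z j] inv absorbing \<open>I y\<close> \<open>y \<in> G\<close> that
      by blast
    then show ?thesis by (intro prob_eq_0) auto
  qed
  show ?case
  proof (cases "x \<in> G")
    case True
    then show ?thesis using stay[OF Suc.prems True, of "Suc k"] \<delta> by simp
  next
    case False
    have "measure_pmf.prob (bind_pmf (f x) (iterate_pmf k f)) (- G)
        \<le> 0 + \<delta> ^ k * measure_pmf.prob (f x) (- G)"
    proof (rule prob_bind_le)
      fix y assume "y \<in> set_pmf (f x)"
      then have "I y" using inv Suc.prems by blast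
      then show "measure_pmf.prob (iterate_pmf k f y) (- G) \<le> 0 + \<delta> ^ k * indicator (- G) y"
        using stay[of y k] Suc.IH[of y] by (auto simp: indicator_def)
    qed
    also have "\<dots> \<le> 0 + \<delta> ^ k * \<delta>"
      using miss[OF Suc.prems False] \<delta> by (intro add_left_mono mult_left_mono) auto
    finally show ?thesis by (simp add: mult.commute)
  qed
qed

text \<open>Union bound over the step at which the chain first leaves \<open>G\<close>; it keeps the
  verdict at 1 through all rounds on an expander.\<close>

lemma prob_iterate_leave_le:
  assumes "\<And>x. x \<in> G \<Longrightarrow> measure_pmf.prob (f x) (- G) \<le> \<delta>"
  shows "x \<in> G \<Longrightarrow> measure_pmf.prob (iterate_pmf k f x) (- G) \<le> real k * \<delta>"
proof (induction k arbitrary: x)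
  case 0
  then show ?case by simp
next
  case (Suc k)
  have \<delta>: "0 \<le> \<delta>" using assms[OF Suc.prems] by (meson measure_nonneg order_trans)
  have "measure_pmf.prob (bind_pmf (f x) (iterate_pmf k f)) (- G)
      \<le> real k * \<delta> + 1 * measure_pmf.prob (f x) (- G)"
  proof (rule prob_bind_le)
    fix y
    have "measure_pmf.prob (iterate_pmf k f y) (- G) \<le> real k * \<delta> + 1" 
      using \<delta> measure_pmf.prob_le_1[of "iterate_pmf k f y" "- G"] by (smt (verit) mult_nonneg_nonneg of_nat_0_le_iff)
    then show "measure_pmf.prob (iterate_pmf k f y) (- G) \<le> real k * \<delta> + 1 * indicator (- G) y"
      using Suc.IH[of y] by (auto simp: indicator_def)
  qed
  with assms[OF Suc.prems] show ?case by (simp add: algebra_simps)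
qed

section \<open>Binary length and powers of one half\<close>

lemma less_two_power_bits: "n < 2 ^ bits n"
proof (induction n rule: less_induct)
  case (less n)
  show ?case
  proof (cases "n = 0")
    case False
    then have "n div 2 < 2 ^ bits (n div 2)" by (intro less.IH) simp
    then show ?thesis using False by (subst bits.simps) simp
  qed (simp add: bits.simps)
qed

lemma two_power_bits_le: "0 < n \<Longrightarrow> 2 ^ bits n \<le> 2 * n"
proof (induction n rule: less_induct)
  case (less n)
  show ?case
  proof (cases "n = 1")
    case False
    then have "2 ^ bits (n div 2) \<le> 2 * (n div 2)" using less.prems by (intro less.IH) auto
    then show ?thesis using less.prems by (subst bits.simps) simp
  qed (simp add: bits.simps)
qed

lemma bits_pos: "0 < n \<Longrightarrow> 0 < bits n"
  by (simp add: bits.simps)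

text \<open>\<open>1 - x \<le> exp (- x)\<close> turns the expected number \<open>x * k\<close> of
  successes into an exponent, and \<open>exp 1 \<ge> 2\<close> trades the base for one half.\<close>

lemma one_minus_power_le:
  fixes x :: real
  assumes "0 \<le> x" "x \<le> 1" "real m \<le> x * real k"
  shows "(1 - x) ^ k \<le> (1 / 2) ^ m"
proof -
  have "(1 - x) ^ k \<le> exp (- x) ^ k"
    using assms exp_ge_add_one_self[of "- x"] by (intro power_mono) auto
  also have "\<dots> = exp (- (x * real k))"
    by (simp add: exp_of_nat_mult[symmetric] mult.commute)
  also have "\<dots> \<le> exp (- real m)"
    using assms by simp
  also have "\<dots> = (1 / exp 1) ^ m"
    by (simp add: exp_of_nat_mult[symmetric] exp_minus power_one_over inverse_eq_divide)
  also have "\<dots> \<le> (1 / 2) ^ m"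
    using exp_ge_add_one_self[of "1::real"] by (intro power_mono) (auto simp: field_simps)
  finally show ?thesis .
qed

section \<open>Error probability\<close>

context adjacency_input
begin

lemma walk_invariant:
  assumes "\<And>u i. u \<in> A \<Longrightarrow> i < d \<Longrightarrow> adj ! u ! i \<in> A" and "u \<in> A"
  shows "set_pmf (walk u) \<subseteq> A"
proof
  fix v assume "v \<in> set_pmf (walk u)"
  then show "v \<in> A"
    unfolding walk_def
    by (rule iterate_pmf_invariant[of "\<lambda>u. u \<in> A", rotated 2]) (use assms in \<open>auto dest!: set_lazy_step[THEN subsetD]\<close>)
qed

lemma length_fill:
  "tbl \<in> set_pmf (iterate_pmf k fill (replicate M 0)) \<Longrightarrow> length tbl = M"
proof (rule iterate_pmf_invariant[of "\<lambda>tbl. length tbl = M", rotated 2])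
  show "length t' = M" if "length t = M" "t' \<in> set_pmf (fill t)" for t t'
    using that(2) by (auto simp: fill_def that(1))
qed auto

text \<open>Unwritten cells hold 0, which lies in \<open>A\<close> too, so every table entry is a
  vertex of \<open>A\<close>. Walks from outside stay outside and cannot match; a round started
  there, which has probability one half, sets verdict 2, and later rounds keep it.\<close>

lemma decide_disconnected:
  assumes A: "A \<subseteq> {..<n}" "2 * card A = n" "0 \<in> A"
    and closed: "\<And>u i. u \<in> A \<Longrightarrow> i < d \<Longrightarrow> adj ! u ! i \<in> A"
      "\<And>u i. u \<in> {..<n} - A \<Longrightarrow> i < d \<Longrightarrow> adj ! u ! i \<in> {..<n} - A"
  shows "measure_pmf.prob decide (- {2}) \<le> (1 / 2) ^ (100 * bits n)"
  unfolding decide_def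
proof (rule prob_bind_le_const)
  fix tbl assume tbl: "tbl \<in> set_pmf (iterate_pmf (404 * M * bits n) fill (replicate M 0))"
  have len: "length tbl = M" by (rule length_fill[OF tbl])
  have "set tbl \<subseteq> A"
    by (rule iterate_pmf_invariant[OF _ _ tbl, where I = "\<lambda>tbl. set tbl \<subseteq> A"])
      (use walk_invariant[of A 0] closed(1) A(3) set_update_subset_insert in
        \<open>fastforce simp: fill_def\<close>)+
  then have tbl_A: "tbl ! (u mod M) \<in> A" for u
    using len M_pos by (auto simp: nth_mem subset_iff)
  have never: "set_pmf (iterate_pmf probes (probe tbl v) 0) \<subseteq> {0}" if "v < n" "v \<notin> A" for v
  proof -
    have "set_pmf (walk v) \<subseteq> {..<n} - A"
      using closed(2) that by (intro walk_invariant) auto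
    then have "tbl ! (u mod M) \<noteq> u" if "u \<in> set_pmf (walk v)" for u
      using that tbl_A[of u] by auto
    then have "set_pmf (probe tbl v 0) \<subseteq> {0}"
      by (auto simp: probe_def)
    then have "h = 0" if "h \<in> set_pmf (iterate_pmf probes (probe tbl v) 0)" for h
      using iterate_pmf_invariant[of "\<lambda>h. h = 0" "probe tbl v" 0 h probes] that by auto
    then show ?thesis by blast
  qed
  have "measure_pmf.prob (test tbl q) (- {2}) \<le> 1 / 2" for q
  proof -
    have "measure_pmf.prob (test tbl q) (- {2}) \<le> 0 + 1 * measure_pmf.prob (pmf_of_set {..<n}) A"
      unfolding test_def
    proof (rule prob_bind_le)
      fix v assume "v \<in> set_pmf (pmf_of_set {..<n})"
      then have v: "v < n" using n_pos by (simp add: lessThan_empty_iff)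
      show "measure_pmf.prob (map_pmf (\<lambda>h. if h = 0 then 2 else q) (iterate_pmf probes (probe tbl v) 0)) (- {2})
          \<le> 0 + 1 * indicator A v"
      proof (cases "v \<in> A")
        case False
        then have "measure_pmf.prob (map_pmf (\<lambda>h. if h = 0 then 2 else q)
            (iterate_pmf probes (probe tbl v) 0)) (- {2}) = 0"
          using never[OF v] by (intro prob_eq_0) auto
        then show ?thesis by simp
      qed simp
    qed
    also have "\<dots> = real (card A) / real n"
      using n_pos A(1) by (simp add: measure_pmf_of_set lessThan_empty_iff Int_absorb1)
    also have "\<dots> = 1 / 2" using A(2) n_pos by (simp add: field_simps)
    finally show ?thesis .
  qed
  then show "measure_pmf.prob (iterate_pmf (100 * bits n) (test tbl) 1) (- {2}) \<le> (1 / 2) ^ (100 * bits n)"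
    by (intro prob_iterate_never_le[where I = "\<lambda>_. True"]) (auto simp: test_def)
qed

section \<open>Error on an expander, from a pointwise lower bound on walk endpoints\<close>

context
  assumes mixing: "\<And>u v. u < n \<Longrightarrow> v < n \<Longrightarrow> 1 / (2 * real n) \<le> pmf (walk u) v"
begin

lemma prob_walk_ge:
  assumes "u < n" "S \<subseteq> {..<n}"
  shows "real (card S) / (2 * real n) \<le> measure_pmf.prob (walk u) S"
proof -
  have "real (card S) / (2 * real n) = (\<Sum>v\<in>S. 1 / (2 * real n))" by simp
  also have "\<dots> \<le> (\<Sum>v\<in>S. pmf (walk u) v)"
    using assms by (intro sum_mono mixing) auto
  also have "\<dots> = measure_pmf.prob (walk u) S"
    using assms(2) by (intro measure_measure_pmf_finite[symmetric]) (auto intro: finite_subset)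
  finally show ?thesis .
qed

text \<open>Rounding loses at most a factor 2: for \<open>M \<le> n\<close> the class has at least
  \<open>n div M\<close> elements, and \<open>q + 1 \<le> 2 * q\<close> for a positive quotient.
  \<open>M\<close> may exceed \<open>n\<close> when \<open>n\<close> is small; then \<open>j\<close>
  itself suffices.\<close>

lemma card_residue_class_ge:
  assumes "j < min M n"
  shows "real n / (2 * real M) \<le> real (card {u. u < n \<and> u mod M = j})"
proof (cases "M \<le> n")
  case True
  have "inj_on (\<lambda>i. i * M + j) {..<n div M}"
    using M_pos by (auto simp: inj_on_def)
  then have "n div M = card ((\<lambda>i. i * M + j) ` {..<n div M})"
    by (simp add: card_image)
  also have "\<dots> \<le> card {u. u < n \<and> u mod M = j}"
  proof (rule card_mono)
    show "(\<lambda>i. i * M + j) ` {..<n div M} \<subseteq> {u. u < n \<and> u mod M = j}"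
    proof safe
      fix i assume "i < n div M"
      then have "Suc i * M \<le> n div M * M" by (intro mult_right_mono) auto
      also have "\<dots> \<le> n" by simp
      finally show "i * M + j < n" using assms by simp
    qed (use assms in simp)
  qed simp
  finally have "real (n div M) \<le> real (card {u. u < n \<and> u mod M = j})" by simp
  moreover have "real n / (2 * real M) \<le> real (n div M)"
  proof -
    have "1 \<le> n div M" using True M_pos by (simp add: Suc_le_eq div_greater_zero_iff)
    have "n < (n div M + 1) * M"
      using M_pos by (metis add.commute dividend_less_div_times mult.commute plus_1_eq_Suc mult_Suc)
    also have "\<dots> \<le> (2 * (n div M)) * M"
      using \<open>1 \<le> n div M\<close> by (intro mult_right_mono) auto
    finally have "real n \<le> real (2 * (n div M) * M)" by (simp only: of_nat_le_iff less_imp_le)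
    then show ?thesis using M_pos by (simp add: field_simps)
  qed
  ultimately show ?thesis by linarith
next
  case False
  have "j \<in> {u. u < n \<and> u mod M = j}" using assms by simp
  then have "{j} \<subseteq> {u. u < n \<and> u mod M = j}" by blast
  then have "card {j} \<le> card {u. u < n \<and> u mod M = j}" by (intro card_mono) auto
  moreover have "real n / (2 * real M) \<le> 1" using False by (simp add: field_simps)
  ultimately show ?thesis by simp
qed

text \<open>The residue condition tells a stored vertex from the initial 0, which is legitimate only
  in cell 0, and makes the entries distinct. For \<open>M > n\<close> only the first
  \<open>n\<close> residues occur, hence the minimum.\<close>

definition full :: "nat list set" where
  "full = {tbl. \<forall>j < min M n. tbl ! j < n \<and> tbl ! j mod M = j}"

lemma prob_fill_not_full:
  "measure_pmf.prob (iterate_pmf (404 * M * bits n) fill (replicate M 0)) (- full) \<le> (1 / 2) ^ (100 * bits n)"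
proof -
  let ?p = "iterate_pmf (404 * M * bits n) fill (replicate M 0)"
  define G where "G j = {tbl. tbl ! j < n \<and> tbl ! j mod M = j}" for j
  have slot: "measure_pmf.prob ?p (- G j) \<le> (1 / 2) ^ (101 * bits n)" if j: "j < min M n" for j
  proof -
    have "measure_pmf.prob ?p (- G j) \<le> (1 - 1 / (4 * real M)) ^ (404 * M * bits n)"
    proof (rule prob_iterate_never_le[where I = "\<lambda>tbl. length tbl = M"])
      \<comment> \<open>Cell \<open>j\<close> is overwritten only by vertices of residue
        \<open>j\<close>, so a filled cell stays filled.\<close>
      show "set_pmf (fill tbl) \<subseteq> G j" if "length tbl = M" "tbl \<in> G j" for tbl
        using that(2) j M_pos walk_less[OF n_pos]
        by (auto simp: fill_def G_def nth_list_update that(1))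
      show "measure_pmf.prob (fill tbl) (- G j) \<le> 1 - 1 / (4 * real M)" if len: "length tbl = M" for tbl
      proof -
        let ?S = "{u. u < n \<and> u mod M = j}"
        have "1 / (4 * real M) = real n / (2 * real M) / (2 * real n)"
          using n_pos by (simp add: field_simps)
        also have "\<dots> \<le> real (card ?S) / (2 * real n)"
          by (intro divide_right_mono card_residue_class_ge j) auto
        also have "\<dots> \<le> measure_pmf.prob (walk 0) ?S"
          using n_pos by (intro prob_walk_ge) auto
        finally have "measure_pmf.prob (walk 0) (- ?S) \<le> 1 - 1 / (4 * real M)"
          using measure_pmf.prob_compl[of ?S "walk 0"] by (simp add: Compl_eq_Diff_UNIV)
        moreover have "measure_pmf.prob (fill tbl) (- G j) \<le> measure_pmf.prob (walk 0) (- ?S)"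
          unfolding fill_def measure_map_pmf
          using len j by (intro measure_pmf.finite_measure_mono) (auto simp: G_def)
        ultimately show ?thesis by linarith
      qed
    qed (use M_pos in \<open>auto simp: fill_def field_simps\<close>)
    also have "\<dots> \<le> (1 / 2) ^ (101 * bits n)"
      using M_pos by (intro one_minus_power_le) (auto simp: field_simps)
    finally show ?thesis .
  qed
  have "- full = (\<Union>j<min M n. - G j)"
    by (auto simp: full_def G_def)
  then have "measure_pmf.prob ?p (- full) = measure_pmf.prob ?p (\<Union>j<min M n. - G j)"
    by simp
  also have "\<dots> \<le> (\<Sum>j<min M n. measure_pmf.prob ?p (- G j))"
    by (intro measure_pmf.finite_measure_subadditive_finite) auto
  also have "\<dots> \<le> (\<Sum>j<min M n. (1 / 2) ^ (101 * bits n))"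
    by (intro sum_mono slot) simp
  also have "\<dots> \<le> 2 ^ bits n * (1 / 2) ^ (101 * bits n)"
  proof -
    have "min M n \<le> 2 ^ bits n" using less_two_power_bits[of n] by simp
    then have "real (min M n) \<le> real (2 ^ bits n)" by (simp only: of_nat_le_iff)
    then show ?thesis by (simp add: mult_right_mono)
  qed
  also have "\<dots> = (2 * (1 / 2)) ^ bits n * (1 / 2) ^ (100 * bits n)"
  proof -
    have "(1 / 2 :: real) ^ (101 * bits n) = (1 / 2) ^ bits n * (1 / 2) ^ (100 * bits n)"
      by (simp add: power_add[symmetric])
    then show ?thesis by (simp only: power_mult_distrib mult.assoc)
  qed
  finally show ?thesis by simp
qed

text \<open>Reduction modulo \<open>M\<close> inverts the table lookup, so a full table recognises
  at least \<open>min M n\<close> distinct vertices; by mixing a walk from any vertex ends in one of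
  them with probability at least \<open>x\<close>.\<close>

lemma prob_round_miss:
  assumes full: "tbl \<in> full" and v: "v < n"
  shows "measure_pmf.prob (iterate_pmf probes (probe tbl v) 0) (- {1}) \<le> (1 / 2) ^ (108 * bits n)"
proof -
  define x where "x = real (min M n) / (2 * real n)"
  have x: "0 \<le> x" "x \<le> 1" using n_pos by (auto simp: x_def field_simps)
  let ?H = "{u. u < n \<and> tbl ! (u mod M) = u}"
  have "inj_on ((!) tbl) {..<min M n}"
    using full by (intro inj_on_inverseI[where g = "\<lambda>u. u mod M"]) (auto simp: full_def)
  then have "min M n = card ((!) tbl ` {..<min M n})"
    by (simp add: card_image)
  also have "\<dots> \<le> card ?H"
    using full by (intro card_mono) (auto simp: full_def)
  finally have card_H: "min M n \<le> card ?H" .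
  have "x \<le> real (card ?H) / (2 * real n)"
    unfolding x_def using card_H by (intro divide_right_mono) (simp_all only: of_nat_le_iff of_nat_0_le_iff mult_nonneg_nonneg zero_le_numeral)
  also have "\<dots> \<le> measure_pmf.prob (walk v) ?H"
    using v by (intro prob_walk_ge) auto
  finally have H: "measure_pmf.prob (walk v) (- ?H) \<le> 1 - x"
    using measure_pmf.prob_compl[of ?H "walk v"] by (simp add: Compl_eq_Diff_UNIV)
  have "measure_pmf.prob (iterate_pmf probes (probe tbl v) 0) (- {1}) \<le> (1 - x) ^ probes"
  proof (rule prob_iterate_never_le[where I = "\<lambda>_. True"])
    show "measure_pmf.prob (probe tbl v h) (- {1}) \<le> 1 - x" for h
    proof -
      have "measure_pmf.prob (probe tbl v h) (- {1}) \<le> measure_pmf.prob (walk v) (- ?H)"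
        unfolding probe_def measure_map_pmf by (intro measure_pmf.finite_measure_mono) auto
      with H show ?thesis by linarith
    qed
  qed (use x in \<open>auto simp: probe_def split: if_splits\<close>)
  also have "\<dots> \<le> (1 / 2) ^ (108 * bits n)"
  proof (rule one_minus_power_le[OF x])
    \<comment> \<open>For \<open>M \<le> n\<close> this is \<open>n \<le> (n div M + 1) * M\<close>;
      for larger \<open>M\<close> already \<open>x\<close> is one half.\<close>
    have "1 / 2 \<le> x * real (n div M + 1)"
    proof (cases "M \<le> n")
      case True
      have "n \<le> (n div M + 1) * M"
        using M_pos by (metis add.commute dividend_less_div_times less_imp_le mult.commute plus_1_eq_Suc mult_Suc)
      then have "real n \<le> real (n div M + 1) * real M"
        by (metis of_nat_le_iff of_nat_mult)
      then show ?thesis using True n_pos by (simp add: x_def min_def field_simps)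
    next
      case False
      then show ?thesis using n_pos by (simp add: x_def min_def)
    qed
    then have "216 * real (bits n) * (1 / 2) \<le> 216 * real (bits n) * (x * real (n div M + 1))"
      by (intro mult_left_mono) auto
    then show "real (108 * bits n) \<le> x * real probes"
      by (simp add: probe_count_def algebra_simps)
  qed
  finally show ?thesis .
qed

text \<open>Two events can spoil the verdict: the table is not full, or some round misses a full
  table. Each contributes \<open>(1/2) ^ (100 * bits n)\<close>, the origin of the factor 2 in the
  error bound.\<close>

lemma decide_mixing:
  "measure_pmf.prob decide (- {1}) \<le> 2 * (1 / 2) ^ (100 * bits n)"
proof -
  let ?\<delta> = "(1 / 2 :: real) ^ (108 * bits n)"
  have round: "measure_pmf.prob (test tbl 1) (- {1}) \<le> ?\<delta>" if "tbl \<in> full" for tbl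
    unfolding test_def
  proof (rule prob_bind_le_const)
    fix v assume "v \<in> set_pmf (pmf_of_set {..<n})"
    then have v: "v < n" using n_pos by (simp add: lessThan_empty_iff)
    have "measure_pmf.prob (map_pmf (\<lambda>h. if h = 0 then 2 else 1 :: nat) (iterate_pmf probes (probe tbl v) 0)) (- {1})
        \<le> measure_pmf.prob (iterate_pmf probes (probe tbl v) 0) (- {1})"
      unfolding measure_map_pmf by (intro measure_pmf.finite_measure_mono) auto
    also have "\<dots> \<le> ?\<delta>" by (rule prob_round_miss[OF that v])
    finally show "measure_pmf.prob (map_pmf (\<lambda>h. if h = 0 then 2 else 1 :: nat)
        (iterate_pmf probes (probe tbl v) 0)) (- {1}) \<le> ?\<delta>" .
  qed
  have union: "real (100 * bits n) * ?\<delta> \<le> (1 / 2) ^ (100 * bits n)"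
  proof -
    \<comment> \<open>As \<open>bits n\<close> is positive,
      \<open>7 + bits n \<le> 8 * bits n\<close>, which is the reserve between 100 and 108.\<close>
    have "100 * bits n \<le> 2 ^ 7 * 2 ^ bits n"
      using less_exp[of "bits n"] by (intro mult_mono) auto
    also have "\<dots> \<le> 2 ^ (8 * bits n)"
      unfolding power_add[symmetric] using bits_pos[OF n_pos] by (intro power_increasing) auto
    finally have "real (100 * bits n) \<le> real (2 ^ (8 * bits n))" by (simp only: of_nat_le_iff)
    then have "real (100 * bits n) * ?\<delta> \<le> 2 ^ (8 * bits n) * ?\<delta>"
      by (intro mult_right_mono) auto
    also have "\<dots> = (2 * (1 / 2)) ^ (8 * bits n) * (1 / 2) ^ (100 * bits n)"
    proof -
      have "?\<delta> = (1 / 2) ^ (8 * bits n) * (1 / 2) ^ (100 * bits n)"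
        by (simp add: power_add[symmetric])
      then show ?thesis by (simp only: power_mult_distrib mult.assoc)
    qed
    finally show ?thesis by simp
  qed
  have "measure_pmf.prob decide (- {1}) \<le> (1 / 2) ^ (100 * bits n) +
      1 * measure_pmf.prob (iterate_pmf (404 * M * bits n) fill (replicate M 0)) (- full)"
    unfolding decide_def
  proof (rule prob_bind_le)
    fix tbl
    show "measure_pmf.prob (iterate_pmf (100 * bits n) (test tbl) 1) (- {1})
        \<le> (1 / 2) ^ (100 * bits n) + 1 * indicator (- full) tbl"
    proof (cases "tbl \<in> full")
      case True
      have "measure_pmf.prob (iterate_pmf (100 * bits n) (test tbl) 1) (- {1}) \<le> real (100 * bits n) * ?\<delta>"
        by (rule prob_iterate_leave_le) (use round[OF True] in auto)
      with union True show ?thesis by simp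
    next
      case False
      have "measure_pmf.prob (iterate_pmf (100 * bits n) (test tbl) 1) (- {1}) \<le> 1" by simp
      also have "1 \<le> (1 / 2 :: real) ^ (100 * bits n) + 1" by simp
      finally show ?thesis using False by simp
    qed
  qed
  with prob_fill_not_full show ?thesis by linarith
qed

end

text \<open>The squared deviation from \<open>1 / n\<close> is at most
  \<open>(1/16) ^ bits n\<close>, hence the deviation at most \<open>(1/4) ^ bits n\<close>, which
  is at most half of \<open>1 / n\<close>.\<close>

lemma walk_mixing:
  assumes expander: "edge_expander {..<n} E d \<phi>" and "\<phi> \<le> 1"
    and adj: "\<And>v. v < n \<Longrightarrow> distinct (adj ! v) \<and> set (adj ! v) = {u. (v, u) \<in> E}"
    and C: "(1 - \<phi>\<^sup>2 / 4) ^ C \<le> 1 / 16"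
    and "u < n" "v < n"
  shows "1 / (2 * real n) \<le> pmf (walk u) v"
proof -
  interpret edge_expander "{..<n}" E d \<phi> by (rule expander)
  \<comment> \<open>Backward equation: \<open>iterate_pmf\<close> splits off the first step, so for
    a fixed target \<open>v\<close> the probabilities, as functions of the start, evolve by
    \<open>lazy_avg\<close> from the indicator of \<open>v\<close>.\<close>
  have step: "pmf (bind_pmf (lazy_step x) g) v = lazy_avg (\<lambda>y. pmf (g y) v) x" if x: "x < n" for g x
  proof -
    let ?F = "\<lambda>y. pmf (g y) v"
    have "pmf (bind_pmf (lazy_step x) g) v =
        (\<Sum>r<2 * d. ?F (if r < d then adj ! x ! r else x)) / real (2 * d)"
      using d_pos by (simp add: pmf_bind lazy_step_def integral_pmf_of_set lessThan_empty_iff)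
    also have "(\<Sum>r<2 * d. ?F (if r < d then adj ! x ! r else x)) =
        (\<Sum>r<d. ?F (adj ! x ! r)) + (\<Sum>r = d..<2 * d. ?F x)"
    proof -
      have "{..<2 * d} = {..<d} \<union> {d..<2 * d}" by auto
      then show ?thesis by (simp add: sum.union_disjoint ivl_disj_int)
    qed
    also have "(\<Sum>r<d. ?F (adj ! x ! r)) = (\<Sum>y | (x, y) \<in> E. ?F y)"
      using adj[OF x] length_nth_adj[OF x] by (intro sum.reindex_bij_betw bij_betw_nth) auto
    finally show ?thesis using d_pos by (simp add: lazy_avg_def field_simps)
  qed
  have "(pmf (walk u) v - 1 / real (card {..<n}))\<^sup>2 \<le> (1 - \<phi>\<^sup>2 / 4) ^ (C * bits n)"
    unfolding walk_def
    by (rule lazy_avg_iterates_near_uniform[where g = "\<lambda>t u. pmf (iterate_pmf t lazy_step u) v" and x = v])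
      (use step assms in \<open>auto simp: indicator_def\<close>)
  also have "\<dots> \<le> (1 / 16) ^ bits n"
  proof -
    have "0 \<le> 1 - \<phi>\<^sup>2 / 4"
      using \<open>\<phi> \<le> 1\<close> \<phi>_pos power_le_one[of \<phi> 2] by simp
    then show ?thesis unfolding power_mult using C by (intro power_mono) auto
  qed
  also have "\<dots> = ((1 / 4) ^ bits n)\<^sup>2"
    by (simp add: power2_eq_square power_mult_distrib[symmetric])
  finally have "\<bar>pmf (walk u) v - 1 / real n\<bar> \<le> (1 / 4) ^ bits n"
    by (simp add: power2_le_iff_abs_le)
  also have "(1 / 4 :: real) ^ bits n \<le> 1 / (2 * real n)"
  proof -
    have "2 * n \<le> 2 ^ bits n * 2 ^ bits n"
      using less_two_power_bits[of n] bits_pos[OF n_pos] power_increasing[of 1 "bits n" "2::nat"]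
      by (intro mult_mono) auto
    also have "\<dots> = 4 ^ bits n" by (simp add: power_mult_distrib[symmetric])
    finally have "2 * real n \<le> 4 ^ bits n" by (metis of_nat_le_iff of_nat_mult of_nat_numeral of_nat_power)
    then show ?thesis using n_pos by (simp add: power_one_over field_simps)
  qed
  finally have "1 / real n - 1 / (2 * real n) \<le> pmf (walk u) v"
    by linarith
  then show ?thesis using n_pos by (simp add: field_simps)
qed

end

section \<open>Resource bounds and correctness\<close>

lemma out_degree_pair: "out_degree (with_proj G) v = card {u. (v, u) \<in> parcs G}"
proof -
  have "out_arcs (with_proj G) v = Pair v ` {u. (v, u) \<in> parcs G}"
    by (auto simp: out_arcs_def)
  then show ?thesis
    by (simp add: out_degree_def card_image inj_on_def)
qed

text \<open>In a regular graph of positive degree the volume constraint of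
  \<open>conductance\<close> becomes a cardinality constraint. Passing to a smaller
  \<open>\<psi>\<close> lets one constant serve all admissible \<open>\<phi>\<close>.\<close>

lemma edge_expander_of_expander:
  assumes G: "pair_graph G" "regular d G" "expander \<phi> G"
    and "0 < d" "0 < \<psi>" "\<psi> \<le> \<phi>"
  shows "edge_expander (pverts G) (parcs G) d \<psi>"
proof
  interpret pair_graph G by (rule G(1))
  show "finite (pverts G)" by (rule pair_finite_verts)
  show arcs: "parcs G \<subseteq> pverts G \<times> pverts G"
    by (auto dest: in_arcsD1 in_arcsD2)
  show "(v, u) \<in> parcs G" if "(u, v) \<in> parcs G" for u v
    using that pair_sym_arcs by (auto simp: symmetric_def dest: symD)
  show "card {u. (v, u) \<in> parcs G} = d" if "v \<in> pverts G" for v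
    using G(2) that by (simp add: regular_def out_degree_pair)
  show "\<psi> * real d * real (card C) \<le> real (card {e \<in> parcs G. fst e \<in> C \<and> snd e \<notin> C})"
    if C: "C \<subseteq> pverts G" "C \<noteq> {}" "2 * card C \<le> card (pverts G)" for C
  proof -
    have vol: "vol G A = d * card A" if "A \<subseteq> pverts G" for A
      using G(2) that by (simp add: vol_def regular_def subset_iff)
    have "finite C" using C(1) pair_finite_verts by (rule finite_subset)
    then have "0 < card C" using C(2) by (simp add: card_gt_0_iff)
    have "real d * (2 * real (card C)) \<le> real d * real (card (pverts G))"
      using C(3) by (intro mult_left_mono) (simp_all add: of_nat_le_iff[symmetric, where ?'a = real] del: of_nat_le_iff)
    then have "C \<in> {C. C \<subseteq> pverts G \<and> 0 < vol G C \<and> real (vol G C) \<le> real (vol G (pverts G)) / 2}"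
      using C(1) \<open>0 < card C\<close> \<open>0 < d\<close> by (simp add: vol)
    then have "conductance G \<le> phi_out G C"
      unfolding conductance_def using pair_finite_verts by (intro Min_le) auto
    then have "\<psi> \<le> phi_out G C"
      using G(3) \<open>\<psi> \<le> \<phi>\<close> by (simp add: expander_def)
    moreover have "cut_arcs G C = {e \<in> parcs G. fst e \<in> C \<and> snd e \<notin> C}"
      using arcs by (auto simp: cut_arcs_def)
    ultimately show ?thesis
      using \<open>0 < card C\<close> \<open>0 < d\<close> C(1) by (simp add: phi_out_def vol pos_le_divide_eq mult.assoc)
  qed
qed fact+

text \<open>\<open>A\<close> is whichever half contains \<open>x\<close>. Every arc belongs to one
  of two graphs with disjoint vertex sets, so none crosses.\<close>

lemma two_identical_expanders_component:
  assumes "two_identical_expanders \<phi> G" "x \<in> pverts G"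
  obtains A where "A \<subseteq> pverts G" "2 * card A = card (pverts G)" "x \<in> A"
    "\<And>u v. (u, v) \<in> parcs G \<Longrightarrow> u \<in> A \<longleftrightarrow> v \<in> A"
proof -
  obtain H1 H2 where H: "pverts H1 \<inter> pverts H2 = {}" "pverts G = pverts H1 \<union> pverts H2"
      "parcs G = parcs H1 \<union> parcs H2" "2 * card (pverts H1) = card (pverts G)"
      "2 * card (pverts H2) = card (pverts G)" "pair_graph H1" "pair_graph H2"
    using assms(1) unfolding two_identical_expanders_def expander_def by blast
  interpret H1: pair_graph H1 by (rule H(6))
  interpret H2: pair_graph H2 by (rule H(7))
  have arcs: "u \<in> pverts H1 \<longleftrightarrow> v \<in> pverts H1" "u \<in> pverts H2 \<longleftrightarrow> v \<in> pverts H2"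
    if "(u, v) \<in> parcs G" for u v
    using that H(1,3) H1.in_arcsD1 H1.in_arcsD2 H2.in_arcsD1 H2.in_arcsD2 by blast+
  show ?thesis
    using that[of "pverts H1"] that[of "pverts H2"] H arcs assms(2) by blast
qed

section \<open>Logarithms, word length and running time\<close>

lemma le_two_power_ceiling_log: "0 < n \<Longrightarrow> n \<le> 2 ^ nat \<lceil>log 2 (real n)\<rceil>"
proof -
  assume n: "0 < n"
  define k where "k = nat \<lceil>log 2 (real n)\<rceil>"
  have "0 \<le> log 2 (real n)" using n by simp
  then have "log 2 (real n) \<le> real k" unfolding k_def by linarith
  then have "real n \<le> 2 powr real k" using n by (simp add: log_le_iff)
  then have "real n \<le> real (2 ^ k)" by (simp add: powr_realpow)
  then show ?thesis unfolding k_def by (simp only: of_nat_le_iff)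
qed

text \<open>The constant factor moves into the exponent by \<open>c < 2 ^ c \<le> n ^ c\<close>, so
  a constant multiple of \<open>log n\<close> bits suffices.\<close>

lemma two_power_word_length_ge:
  assumes "2 \<le> n"
  shows "c * n\<^sup>2 < 2 ^ word_length (c + 2) n"
proof -
  let ?L = "nat \<lceil>log 2 (real n)\<rceil>"
  have "c * n\<^sup>2 < 2 ^ c * n\<^sup>2"
    using assms less_exp[of c] by simp
  also have "\<dots> \<le> n ^ c * n\<^sup>2"
    using assms by (intro mult_right_mono power_mono) auto
  also have "\<dots> = n ^ (c + 2)" by (simp only: power_add)
  also have "\<dots> \<le> (2 ^ ?L) ^ (c + 2)"
    using assms by (intro power_mono le_two_power_ceiling_log) auto
  finally show ?thesis by (simp only: word_length_def power_mult mult.commute[of "c + 2"])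
qed

lemma ln_ge_half: "2 \<le> n \<Longrightarrow> 1 / 2 \<le> ln (real n)"
proof -
  assume n: "2 \<le> n"
  have "1 / 2 \<le> ln (2 :: real)"
    using ln_le_minus_one[of "1 / 2 :: real"] by (simp add: ln_div)
  also have "\<dots> \<le> ln (real n)" using n by simp
  finally show ?thesis .
qed

lemma log2_le_ln: "2 \<le> n \<Longrightarrow> log 2 (real n) + 1 \<le> 4 * ln (real n)"
proof -
  assume n: "2 \<le> n"
  have "1 \<le> 2 * ln (2 :: real)" using ln_ge_half[of 2] by simp
  moreover have "0 \<le> ln (real n)" using n by simp
  ultimately have "1 * ln (real n) \<le> (2 * ln 2) * ln (real n)" by (intro mult_right_mono)
  then have "log 2 (real n) \<le> 2 * ln (real n)"
    by (simp add: log_def field_simps)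
  then show ?thesis using ln_ge_half[OF n] by linarith
qed

lemma bits_le_ln:
  assumes "2 \<le> n"
  shows "real (bits n) \<le> 4 * ln (real n)"
proof -
  have "real (2 ^ bits n) \<le> real (2 * n)"
    unfolding of_nat_le_iff using assms by (intro two_power_bits_le) simp
  then have "2 ^ bits n \<le> 2 * real n" by simp
  then have "log 2 (2 ^ bits n) \<le> log 2 (2 * real n)"
    using assms by (subst log_le_cancel_iff) auto
  then have "real (bits n) \<le> log 2 (real n) + 1"
    using assms by (simp add: log_mult log_nat_power)
  then show ?thesis using log2_le_ln[OF assms] by linarith
qed

lemma word_length_le_ln:
  assumes "2 \<le> n"
  shows "real (word_length c n) \<le> real c * (4 * ln (real n))"
proof -
  have "0 \<le> log 2 (real n)" using assms by simp
  then have "real (nat \<lceil>log 2 (real n)\<rceil>) \<le> log 2 (real n) + 1" by linarith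
  then have "real (nat \<lceil>log 2 (real n)\<rceil>) \<le> 4 * ln (real n)"
    using log2_le_ln[OF assms] by linarith
  then show ?thesis
    by (simp add: word_length_def mult_left_mono)
qed

text \<open>The cube stems from testing: rounds, walks per round and walk length each contribute a
  factor \<open>bits n\<close>. Of 30000, testing takes 21600 = 100 * 216 and lower-order terms at
  most 2000.\<close>

lemma decide_steps_le:
  assumes "0 < bits n"
  shows "decide_steps C n M \<le> 30000 * (11 * C + 16) * (M + (n div M + 1)) * bits n ^ 3"
proof -
  define l N a where "l = bits n" and "N = n div M + 1" and "a = 11 * C + 16"
  have l: "1 \<le> l" using assms by (simp add: l_def)
  have N: "1 \<le> N" and a: "1 \<le> a" by (auto simp: N_def a_def)
  have l3: "1 \<le> l ^ 3" "l \<le> l ^ 3" "l * l \<le> l ^ 3" 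
    using l self_le_power[of l 3] power_increasing[of 2 3 l] by (auto simp: power2_eq_square)
  have walk: "walk_steps C n + 12 \<le> a * l"
    using l by (simp add: walk_steps_def a_def l_def[symmetric] algebra_simps)
  have "fill_steps C n M \<le> 404 * M * l * (a * l) + 4"
    unfolding fill_steps_def l_def[symmetric] using walk by (intro add_mono mult_left_mono) auto
  also have "\<dots> = 404 * M * a * (l * l) + 4" by (simp add: algebra_simps)
  also have "\<dots> \<le> 404 * M * a * l ^ 3 + 4 * l ^ 3"
    using l3 by (intro add_mono mult_left_mono) auto
  finally have fill: "fill_steps C n M \<le> 404 * M * a * l ^ 3 + 4 * l ^ 3" .
  have "round_steps C n M \<le> 216 * l * N * (a * l) + 4"
    unfolding round_steps_def probe_count_def l_def[symmetric] N_def[symmetric]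
    using walk by (intro add_mono mult_left_mono) auto
  then have "test_steps C n M \<le> 100 * l * (216 * l * N * (a * l) + 4 + 14) + 4"
    unfolding test_steps_def l_def[symmetric] by (intro add_mono mult_left_mono) auto
  also have "\<dots> = 21600 * a * N * l ^ 3 + 1800 * l + 4"
    by (simp add: algebra_simps power3_eq_cube)
  finally have test: "test_steps C n M \<le> 21600 * a * N * l ^ 3 + 1800 * l + 4" .
  have "1 * 1 * l ^ 3 \<le> a * N * l ^ 3"
    using a N by (intro mult_mono) auto
  then have aN: "l ^ 3 \<le> a * N * l ^ 3" by simp
  have "decide_steps C n M \<le> 404 * M * a * l ^ 3 + 21600 * a * N * l ^ 3 + (6 * l + 4 * l ^ 3 + 1800 * l + 16)"
    unfolding decide_steps_def l_def[symmetric] using fill test by linarith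
  also have "6 * l + 4 * l ^ 3 + 1800 * l + 16 \<le> 2000 * l ^ 3"
    using l3 by linarith
  also have "\<dots> \<le> 2000 * (a * N * l ^ 3)"
    using aN by simp
  also have "404 * M * a * l ^ 3 + 21600 * a * N * l ^ 3 + 2000 * (a * N * l ^ 3) \<le> 30000 * a * (M + N) * l ^ 3"
  proof -
    have "404 * (M * a * l ^ 3) + 23600 * (a * N * l ^ 3) \<le> 30000 * (M * a * l ^ 3) + 30000 * (a * N * l ^ 3)"
      by (intro add_mono mult_right_mono) auto
    then show ?thesis by (simp add: algebra_simps)
  qed
  finally show ?thesis by (simp add: l_def N_def a_def)
qed

text \<open>With the crude bound \<open>bits n \<le> 2 * n\<close> every relevant quantity is at
  most quadratic in \<open>n\<close>. In the coefficient, \<open>2 * C\<close> is for the walk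
  counter, \<open>2 * D\<close> for the random range, \<open>808 * b\<close> for the filling
  counter, and 1024 exceeds the 864 = 216 * 2 * 2 of the probe counter.\<close>

lemma adjacency_inputI:
  assumes n: "2 \<le> n" and d: "1 \<le> d" "d \<le> D" and M: "1 \<le> M" "M \<le> b * n"
    and G: "pair_graph G" "pverts G = {..<n}" "regular d G" "adjacency_lists G adj"
  shows "adjacency_input (word_length (1024 + 2 * C + 2 * D + 808 * b + 2) n) adj n d M C"
proof -
  let ?w = "word_length (1024 + 2 * C + 2 * D + 808 * b + 2) n"
  interpret pair_graph G by (rule G(1))
  have "(1024 + 2 * C + 2 * D + 808 * b) * n\<^sup>2 < 2 ^ ?w"
    by (rule two_power_word_length_ge[OF n])
  then have w: "1024 * n\<^sup>2 + 2 * (C * n\<^sup>2) + 2 * (D * n\<^sup>2) + 808 * (b * n\<^sup>2) < 2 ^ ?w"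
    by (simp add: algebra_simps)
  have sq: "1 \<le> n\<^sup>2" "n \<le> n\<^sup>2"
    using n self_le_power[of n 2] by auto
  have scaled: "x \<le> x * n\<^sup>2" "x * n \<le> x * n\<^sup>2" for x
    using sq by auto
  have bits: "bits n \<le> 2 * n"
    using less_exp[of "bits n"] two_power_bits_le[of n] n by linarith
  have length: "length adj = n"
    using G(2,4) by (simp add: adjacency_lists_def)
  have adj: "distinct (adj ! v)" "set (adj ! v) = {u. (v, u) \<in> parcs G}" if "v < n" for v
    using G(4) length that by (auto simp: adjacency_lists_def)
  show ?thesis
  proof
    show "length (adj ! v) = d" if v: "v < n" for v
      using distinct_card[OF adj(1)[OF v]] adj(2)[OF v] G(2,3) v
      by (simp add: regular_def out_degree_pair)
    then show "adj ! v ! i < n" if "v < n" "i < d" for v i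
      using nth_mem[of i "adj ! v"] adj(2)[of v] that in_arcsD2[of v "adj ! v ! i"] G(2) by auto
    show "1024 \<le> (2::nat) ^ ?w" "n < 2 ^ ?w" using w sq by linarith+
    show "C < 2 ^ ?w" using w sq scaled(1)[of C] by linarith
    show "2 * d < 2 ^ ?w" using w sq scaled(1)[of D] d by linarith
    show "13 + M < 2 ^ ?w" using w sq scaled(2)[of b] M by linarith
    have "C * bits n \<le> C * (2 * n)" using bits by simp
    also have "\<dots> = 2 * (C * n)" by simp
    finally show "C * bits n < 2 ^ ?w" using w sq scaled(2)[of C] by linarith
    have "404 * M * bits n \<le> 404 * (b * n) * (2 * n)"
      using bits M by (intro mult_mono) auto
    also have "\<dots> = 808 * (b * n\<^sup>2)" by (simp add: power2_eq_square)
    finally show "404 * M * bits n < 2 ^ ?w" using w sq by linarith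
    have "n div M + 1 \<le> 2 * n"
      using n div_le_dividend[of n M] by linarith
    then have "216 * bits n * (n div M + 1) \<le> 216 * (2 * n) * (2 * n)"
      using bits by (intro mult_mono) auto
    also have "\<dots> = 864 * n\<^sup>2" by (simp add: power2_eq_square)
    finally show "216 * bits n * (n div M + 1) < 2 ^ ?w" using w sq by linarith
    show "100 * bits n < 2 ^ ?w" using w sq bits by linarith
  qed (use length n d M in auto)
qed

lemma decide_correct:
  assumes n: "2 \<le> n" and d: "1 \<le> d" "d \<le> D" and M: "1 \<le> M" "M \<le> b * n"
    and \<psi>: "0 < \<psi>" "\<psi> \<le> 1" "\<psi> \<le> \<phi>" "(1 - \<psi>\<^sup>2 / 4) ^ C \<le> 1 / 16"
    and G: "pair_graph G" "pverts G = {..<n}" "regular d G" "adjacency_lists G adj"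
  defines "w \<equiv> word_length (1024 + 2 * C + 2 * D + 808 * b + 2) n"
  defines "result \<equiv> run w adj (decide_steps C n M) (Some (decide_com C, initial_memory w (13 + M) [n, d, M]))"
  shows "set_pmf result \<subseteq> halted"
    and "expander \<phi> G \<Longrightarrow> 1 - 2 * real n powr (- 100) \<le> measure_pmf.prob result (halted_with 1)"
    and "two_identical_expanders \<phi> G \<Longrightarrow>
      1 - 2 * real n powr (- 100) \<le> measure_pmf.prob result (halted_with 2)"
proof -
  interpret adjacency_input w adj n d M C
    unfolding w_def by (rule adjacency_inputI) fact+
  interpret pair_graph G by (rule G(1))
  note run = run_decide[folded result_def]
  show "set_pmf result \<subseteq> halted" by (rule run(1))
  have adj: "distinct (adj ! v) \<and> set (adj ! v) = {u. (v, u) \<in> parcs G}" if "v < n" for v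
    using G(2,4) that by (simp add: adjacency_lists_def)
  have result: "measure_pmf.prob result (halted_with r) = 1 - measure_pmf.prob decide (- {r})" for r
    using run(2)[of r] measure_pmf.prob_compl[of "{r}" decide] by (simp add: Compl_eq_Diff_UNIV)
  have small: "(1 / 2 :: real) ^ (100 * bits n) \<le> real n powr (- 100)"
  proof -
    have "real n \<le> real (2 ^ bits n)"
      unfolding of_nat_le_iff using less_two_power_bits[of n] by simp
    then have "real n ^ 100 \<le> (2 ^ bits n) ^ 100" by (intro power_mono) auto
    then have "inverse ((2 ^ bits n) ^ 100) \<le> inverse (real n ^ 100)"
      using n by (intro le_imp_inverse_le) auto
    moreover have "real n powr (- 100) = inverse (real n ^ 100)"
      using n by (simp add: powr_minus powr_numeral)
    moreover have "(1 / 2 :: real) ^ (100 * bits n) = inverse ((2 ^ bits n) ^ 100)"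
      by (simp add: power_mult[symmetric] mult.commute power_one_over inverse_eq_divide)
    ultimately show ?thesis by simp
  qed
  show "1 - 2 * real n powr (- 100) \<le> measure_pmf.prob result (halted_with 1)" if "expander \<phi> G"
  proof -
    have "edge_expander (pverts G) (parcs G) d \<psi>"
      by (rule edge_expander_of_expander[OF G(1,3) that d_pos \<psi>(1,3)])
    then have "measure_pmf.prob decide (- {1}) \<le> 2 * (1 / 2) ^ (100 * bits n)"
      unfolding G(2) by (rule decide_mixing[OF walk_mixing[OF _ \<psi>(2) adj \<psi>(4)]])
    then show ?thesis using small result[of 1] by linarith
  qed
  show "1 - 2 * real n powr (- 100) \<le> measure_pmf.prob result (halted_with 2)"
    if two: "two_identical_expanders \<phi> G"
  proof -
    have "0 \<in> pverts G" using G(2) n by simp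
    then obtain A where A: "A \<subseteq> pverts G" "2 * card A = card (pverts G)" "0 \<in> A"
        "\<And>u v. (u, v) \<in> parcs G \<Longrightarrow> u \<in> A \<longleftrightarrow> v \<in> A"
      using two_identical_expanders_component[OF two] by blast
    have arc: "(u, adj ! u ! i) \<in> parcs G" if "u < n" "i < d" for u i
      using adj[OF that(1)] length_nth_adj[OF that(1)] nth_mem[of i "adj ! u"] that(2) by auto
    have "measure_pmf.prob decide (- {2}) \<le> (1 / 2) ^ (100 * bits n)"
    proof (rule decide_disconnected)
      show "adj ! u ! i \<in> A" if "u \<in> A" "i < d" for u i
        using A(1,4) G(2) arc[of u i] that by blast
      show "adj ! u ! i \<in> {..<n} - A" if "u \<in> {..<n} - A" "i < d" for u i
        using A(4) arc[of u i] nth_nth_adj[of u i] that by blast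
    qed (use A G(2) in auto)
    moreover have "0 \<le> real n powr (- 100)" by simp
    ultimately show ?thesis using small result[of 2] by linarith
  qed
qed

theorem theorem2:
  fixes \<phi>\<^sub>0 B :: real and D :: nat
  assumes "\<phi>\<^sub>0 > 0"
  shows "\<exists>(P :: com) (c :: nat) (K :: real) (k :: nat).
    \<forall>(n :: nat) (d :: nat) (M :: nat).
      1 \<le> d \<and> d \<le> D \<and> 1 \<le> M \<and> real M \<le> B * sqrt (real n) \<longrightarrow>
      (\<exists>(s :: nat) (T :: nat).
         3 \<le> s \<and>
         real (word_length c n * s) \<le> K * real M * ln (real n) ^ k \<and>
         real T \<le> K * (real n / real M) * ln (real n) ^ k \<and>
         (\<forall>(\<phi> :: real) (G :: nat pair_pre_digraph) (adj :: nat list list).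
            \<phi>\<^sub>0 \<le> \<phi> \<and> pair_graph G \<and> pverts G = {..<n} \<and> regular d G \<and> adjacency_lists G adj \<and>
            (expander \<phi> G \<or> two_identical_expanders \<phi> G) \<longrightarrow>
            (let w = word_length c n;
                 result = run w adj T (Some (P, initial_memory w s [n, d, M]))
             in set_pmf result \<subseteq> halted \<and>
                (expander \<phi> G \<longrightarrow>
                   measure_pmf.prob result (halted_with 1) \<ge> 1 - 2 * real n powr (- 100)) \<and>
                (two_identical_expanders \<phi> G \<longrightarrow>
                   measure_pmf.prob result (halted_with 2) \<ge> 1 - 2 * real n powr (- 100)))))"
proof -
  \<comment> \<open>Capping at 1 keeps the contraction factor \<open>1 - \<psi>\<^sup>2 / 4\<close>
    between 0 and 1. \<open>C\<close> then depends on \<open>\<phi>\<^sub>0\<close> alone, so the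
    program is fixed before \<open>n\<close>, \<open>d\<close> and \<open>M\<close>.\<close>
  define \<psi> where "\<psi> = min \<phi>\<^sub>0 1"
  have \<psi>: "0 < \<psi>" "\<psi> \<le> 1" "\<psi> \<le> \<phi>\<^sub>0" using assms by (auto simp: \<psi>_def)
  have "1 - \<psi>\<^sup>2 / 4 < 1" using \<psi> by simp
  then obtain C where "(1 - \<psi>\<^sup>2 / 4) ^ C < 1 / 16"
    using real_arch_pow_inv[of "1 / 16" "1 - \<psi>\<^sup>2 / 4"] by auto
  then have C: "(1 - \<psi>\<^sup>2 / 4) ^ C \<le> 1 / 16" by simp
  define b where "b = nat \<lceil>\<bar>B\<bar>\<rceil>"
  define c where "c = 1024 + 2 * C + 2 * D + 808 * b + 2"
  define a where "a = 11 * C + 16"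
  \<comment> \<open>224 = 4 * 14 * 4 collects the word length, \<open>13 + M \<le> 14 * M\<close>
    and \<open>x \<le> 4 * x ^ 3\<close>; 1920000 = 30000 * 4 ^ 3 uses
    \<open>bits n \<le> 4 * ln n\<close>. In the last factor 1 stands for \<open>n div M\<close>,
    \<open>\<bar>B\<bar>\<close> for the added 1 and \<open>B\<^sup>2\<close> for
    \<open>M\<close>.\<close>
  define K where "K = 224 * real c + 1920000 * real a * (1 + \<bar>B\<bar> + B\<^sup>2)"
  show ?thesis
  proof (rule exI[of _ "decide_com C"], rule exI[of _ c], rule exI[of _ K], rule exI[of _ 3],
      intro allI impI, elim conjE)
    fix n d M :: nat
    assume d: "1 \<le> d" "d \<le> D" and M1: "1 \<le> M" and MB: "real M \<le> B * sqrt (real n)"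
    have n0: "n \<noteq> 0" using M1 MB by (intro notI) simp
    let ?P = "\<lambda>s T. 3 \<le> s \<and>
         real (word_length c n * s) \<le> K * real M * ln (real n) ^ 3 \<and>
         real T \<le> K * (real n / real M) * ln (real n) ^ 3 \<and>
         (\<forall>(\<phi> :: real) (G :: nat pair_pre_digraph) (adj :: nat list list).
            \<phi>\<^sub>0 \<le> \<phi> \<and> pair_graph G \<and> pverts G = {..<n} \<and> regular d G \<and> adjacency_lists G adj \<and>
            (expander \<phi> G \<or> two_identical_expanders \<phi> G) \<longrightarrow>
            (let w = word_length c n;
                 result = run w adj T (Some (decide_com C, initial_memory w s [n, d, M]))
             in set_pmf result \<subseteq> halted \<and>
                (expander \<phi> G \<longrightarrow>
                   measure_pmf.prob result (halted_with 1) \<ge> 1 - 2 * real n powr (- 100)) \<and>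
                (two_identical_expanders \<phi> G \<longrightarrow>
                   measure_pmf.prob result (halted_with 2) \<ge> 1 - 2 * real n powr (- 100))))"
    show "\<exists>s T. ?P s T"
    proof (cases "n = 1")
      case True
      have no_graph: "\<not> (pair_graph G \<and> pverts G = {..<n} \<and> regular d G)" for G :: "nat pair_pre_digraph"
      proof
        assume *: "pair_graph G \<and> pverts G = {..<n} \<and> regular d G"
        then interpret pair_graph G by blast
        have "card {u. (0, u) \<in> parcs G} = d"
          using * True by (auto simp: regular_def out_degree_pair)
        then have "{u. (0, u) \<in> parcs G} \<noteq> {}" using d(1) by force
        then obtain u where u: "(0, u) \<in> parcs G" by blast
        then have "u = 0" using * True in_arcsD2[of 0 u] by auto
        then show False using no_loops'[OF u] by simp
      qed
      \<comment> \<open>Here \<open>ln n = 0\<close> forces both resource bounds to 0: words have no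
        bits and \<open>T\<close> is 0. The promise is void, as a loop-free graph on one vertex has
        no positive degree.\<close>
      have "?P 3 0"
        using True no_graph by (auto simp: word_length_def)
      then show ?thesis by blast
    next
      case False
      then have n: "2 \<le> n" using n0 by linarith
      define x where "x = ln (real n)"
      have x: "1 / 2 \<le> x" unfolding x_def by (rule ln_ge_half[OF n])
      have sqrt_le: "1 \<le> sqrt (real n)" "sqrt (real n) \<le> real n"
        using n by (auto simp: real_le_lsqrt real_le_rsqrt power2_eq_square)
      have B: "0 < B" using M1 MB sqrt_le by (smt (verit) mult_nonpos_nonneg of_nat_1 of_nat_mono)
      have "real M \<le> B * real n"
        using MB mult_left_mono[OF sqrt_le(2), of B] B by linarith
      also have "\<dots> \<le> real b * real n"
        unfolding b_def by (intro mult_right_mono) linarith+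
      finally have Mb: "M \<le> b * n" by (metis of_nat_le_iff of_nat_mult)
      have M_pos: "0 < real M" using M1 by simp
      \<comment> \<open>The bound on \<open>M\<close> by a multiple of \<open>sqrt n\<close> makes
        the filling phase fit into \<open>n / M\<close>.\<close>
      have M_le: "real M \<le> B\<^sup>2 * (real n / real M)"
      proof -
        have "(real M)\<^sup>2 \<le> (B * sqrt (real n))\<^sup>2" using MB by (intro power_mono) auto
        then have "(real M)\<^sup>2 \<le> B\<^sup>2 * real n" by (simp add: power_mult_distrib)
        then show ?thesis using M_pos by (simp add: pos_le_divide_eq power2_eq_square)
      qed
      \<comment> \<open>The added 1 is absorbed because \<open>M \<le> B * n\<close>.\<close>
      have N_le: "real (n div M + 1) \<le> (1 + B) * (real n / real M)"
      proof -
        have "real (n div M) \<le> real n / real M" by (rule of_nat_div_le_of_nat)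
        moreover have "1 \<le> B * (real n / real M)"
          using \<open>real M \<le> B * real n\<close> M_pos by (simp add: pos_le_divide_eq)
        ultimately show ?thesis unfolding distrib_right by linarith
      qed
      have x3: "x \<le> 4 * x ^ 3"
      proof -
        have "(1 / 2)\<^sup>2 \<le> x\<^sup>2" using x by (intro power_mono) auto
        then have "x * (1 / 4) \<le> x * x\<^sup>2" using x by (intro mult_left_mono) (auto simp: power2_eq_square)
        then show ?thesis by (simp add: power3_eq_cube power2_eq_square)
      qed
      have space: "real (word_length c n * (13 + M)) \<le> K * real M * x ^ 3"
      proof -
        have "real (word_length c n * (13 + M)) \<le> (real c * (4 * x)) * (14 * real M)"
          unfolding of_nat_mult x_def using M1 x word_length_le_ln[OF n, of c]
          by (intro mult_mono) (auto simp: x_def)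
        also have "\<dots> = 56 * real c * real M * x" by simp
        also have "\<dots> \<le> 56 * real c * real M * (4 * x ^ 3)"
          using x3 by (intro mult_left_mono) auto
        also have "\<dots> = 224 * real c * (real M * x ^ 3)" by simp
        also have "\<dots> \<le> K * (real M * x ^ 3)"
          unfolding K_def using x B by (intro mult_right_mono) auto
        finally show ?thesis by (simp add: mult.assoc)
      qed
      have time: "real (decide_steps C n M) \<le> K * (real n / real M) * x ^ 3"
      proof -
        have "real (decide_steps C n M) \<le> real (30000 * a * (M + (n div M + 1)) * bits n ^ 3)"
          unfolding of_nat_le_iff a_def using n by (intro decide_steps_le bits_pos) simp
        also have "\<dots> = 30000 * real a * (real M + real (n div M + 1)) * real (bits n) ^ 3"
          by (simp only: of_nat_add of_nat_mult of_nat_power of_nat_numeral)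
        also have "\<dots> \<le> 30000 * real a * ((1 + B + B\<^sup>2) * (real n / real M)) * (4 * x) ^ 3"
        proof (intro mult_mono power_mono)
          show "real M + real (n div M + 1) \<le> (1 + B + B\<^sup>2) * (real n / real M)"
            using M_le N_le unfolding distrib_right by linarith
          show "real (bits n) \<le> 4 * x" unfolding x_def by (rule bits_le_ln[OF n])
        qed (use B in auto)
        also have "\<dots> = (1920000 * real a * (1 + B + B\<^sup>2)) * ((real n / real M) * x ^ 3)"
          by (simp add: power_mult_distrib)
        also have "\<dots> \<le> K * ((real n / real M) * x ^ 3)"
          unfolding K_def using x B by (intro mult_right_mono) auto
        finally show ?thesis by (simp only: mult.assoc)
      qed
      have "?P (13 + M) (decide_steps C n M)"
        unfolding Let_def x_def[symmetric] c_def
      proof (intro conjI allI impI; (elim conjE)?)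
        show "real (word_length (1024 + 2 * C + 2 * D + 808 * b + 2) n * (13 + M)) \<le> K * real M * x ^ 3"
          using space by (simp only: c_def)
        show "real (decide_steps C n M) \<le> K * (real n / real M) * x ^ 3" by (rule time)
      next
        fix \<phi> :: real and G :: "nat pair_pre_digraph" and adj :: "nat list list"
        assume "\<phi>\<^sub>0 \<le> \<phi>" and G: "pair_graph G" "pverts G = {..<n}" "regular d G" "adjacency_lists G adj"
        with \<psi> have "\<psi> \<le> \<phi>" by simp
        note correct = decide_correct[OF n d M1 Mb \<psi>(1,2) this C G]
        show "set_pmf (run (word_length (1024 + 2 * C + 2 * D + 808 * b + 2) n) adj (decide_steps C n M)
            (Some (decide_com C, initial_memory (word_length (1024 + 2 * C + 2 * D + 808 * b + 2) n)
              (13 + M) [n, d, M]))) \<subseteq> halted"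
          by (rule correct(1))
        show "1 - 2 * real n powr (- 100) \<le> measure_pmf.prob
            (run (word_length (1024 + 2 * C + 2 * D + 808 * b + 2) n) adj (decide_steps C n M)
            (Some (decide_com C, initial_memory (word_length (1024 + 2 * C + 2 * D + 808 * b + 2) n)
              (13 + M) [n, d, M]))) (halted_with 1)" if "expander \<phi> G"
          by (rule correct(2)[OF that])
        show "1 - 2 * real n powr (- 100) \<le> measure_pmf.prob
            (run (word_length (1024 + 2 * C + 2 * D + 808 * b + 2) n) adj (decide_steps C n M)
            (Some (decide_com C, initial_memory (word_length (1024 + 2 * C + 2 * D + 808 * b + 2) n)
              (13 + M) [n, d, M]))) (halted_with 2)" if "two_identical_expanders \<phi> G"
          by (rule correct(3)[OF that])
      qed simp
      then show ?thesis by blast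
    qed
  qed
qed

end
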